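(* Let $\rho_r\in(0,1)$, $\rho_w\in(0,1/2)$, $\epsilon>0$ with $\rho_r<1-h(\rho_w)-2\epsilon$. Let $C\subseteq\{0,1\}^n$ consist of $2^{Rn}$ independent uniformly random vectors, $R=1-h(\rho_w)-\epsilon$, and let $\Pi=\{A_i\}$ be a partition of $C$ into $2^{Rn-\ell}$ subsets of size $2^{\ell}$, where $\ell=\rho_r n-O(1)$ (for a suitable constant). Then with high probability over the choices of $C$ and $\Pi$, the stochastic code $C_\Pi$ that maps the $i$-th message $m_i\in\{0,1\}^{Rn-\ell}$ to a uniformly random element of $A_i$ has rate at least $1-h(\rho_w)-\rho_r-\epsilon$ and achieves reliability and weak secrecy over the $(\rho_r,\rho_w)$ adversarial wiretap channel.
   Context: $h$ is the binary entropy function. The $(\rho_r,\rho_w)$ adversarial wiretap channel: the transmitted codeword $x\in\{0,1\}^n$ encodes message $\mathbf S$; the adversary picks $\mathscr S\subseteq[n]$ of size $\rho_r n$, sees $\mathbf V(\mathscr S)\in\{0,1,?\}^n$ ($x_i$ on $\mathscr S$, $?$ elsewhere), and adds an error of Hamming weight at most $\rho_w n$ whose distribution depends only on the code and the view; the receiver uses nearest-neighbor decoding. Reliability: $\Pr[\hat{\mathbf S}\ne\mathbf S]\to0$ as $n\to\infty$ for uniform messages, against every adversary. Weak secrecy: with $\mathbf S$ uniform, $\frac1n\min_{|\mathscr S|=\rho_r n}H(\mathbf S\mid\mathbf V(\mathscr S))$ tends to the rate of the code as $n\to\infty$. *)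

theory Defs
  imports "HOL-Probability.Probability"
begin

definition bin_entropy :: "real \<Rightarrow> real" where
  "bin_entropy p = - p * log 2 p - (1 - p) * log 2 (1 - p)"

definition vecs :: "nat \<Rightarrow> bool list set" where
  "vecs n = {xs. length xs = n}"

definition hdist :: "bool list \<Rightarrow> bool list \<Rightarrow> nat" where
  "hdist xs ys = card {i. i < length xs \<and> xs ! i \<noteq> ys ! i}"

definition hweight :: "bool list \<Rightarrow> nat" where
  "hweight e = length (filter id e)"

definition xorv :: "bool list \<Rightarrow> bool list \<Rightarrow> bool list" where
  "xorv xs ys = map2 (\<noteq>) xs ys"

definition view :: "nat set \<Rightarrow> bool list \<Rightarrow> bool option list" where
  "view S x = map (\<lambda>i. if i \<in> S then Some (x ! i) else None) [0..<length x]"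

text \<open>Stochastic code: codewords indexed by (message i, key j); A_i = {code (i,j) | j}.
  k = log2 of the number of codewords, l = log2 of the block size.\<close>
definition msgs :: "nat \<Rightarrow> nat \<Rightarrow> nat set" where
  "msgs k l = {..<2 ^ (k - l)}"

definition keys :: "nat \<Rightarrow> nat set" where
  "keys l = {..<2 ^ l}"

definition random_code :: "nat \<Rightarrow> nat \<Rightarrow> nat \<Rightarrow> (nat \<times> nat \<Rightarrow> bool list) pmf" where
  "random_code n k l = Pi_pmf (msgs k l \<times> keys l) [] (\<lambda>_. pmf_of_set (vecs n))"

definition nn_decode :: "nat \<Rightarrow> nat \<Rightarrow> (nat \<times> nat \<Rightarrow> bool list) \<Rightarrow> bool list \<Rightarrow> nat" where
  "nn_decode k l code y = fst (arg_min_on (\<lambda>p. hdist (code p) y) (msgs k l \<times> keys l))"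

text \<open>Admissible (rho_r, rho_w) adversary: reads a set S of size rho_r n, and
  chooses the error distribution as a function of the view (the code is fixed).\<close>
definition adversary_ok ::
  "nat \<Rightarrow> real \<Rightarrow> real \<Rightarrow> nat set \<Rightarrow> (bool option list \<Rightarrow> bool list pmf) \<Rightarrow> bool" where
  "adversary_ok n \<rho>r \<rho>w S E \<longleftrightarrow>
     S \<subseteq> {..<n} \<and> card S = nat \<lfloor>\<rho>r * real n\<rfloor> \<and>
     (\<forall>v. \<forall>e\<in>set_pmf (E v). length e = n \<and> real (hweight e) \<le> \<rho>w * real n)"

definition err_prob ::
  "nat \<Rightarrow> nat \<Rightarrow> (nat \<times> nat \<Rightarrow> bool list) \<Rightarrow> nat set \<Rightarrow> (bool option list \<Rightarrow> bool list pmf) \<Rightarrow> real" where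
  "err_prob k l code S E = measure_pmf.prob
     (do { m \<leftarrow> pmf_of_set (msgs k l);
           j \<leftarrow> pmf_of_set (keys l);
           e \<leftarrow> E (view S (code (m, j)));
           return_pmf (nn_decode k l code (xorv (code (m, j)) e) \<noteq> m) }) {True}"

definition entropy_pmf :: "'a pmf \<Rightarrow> real" where
  "entropy_pmf p = - (\<Sum>x\<in>set_pmf p. pmf p x * log 2 (pmf p x))"

definition cond_entropy_pmf :: "('a \<times> 'b) pmf \<Rightarrow> real" where
  "cond_entropy_pmf p = entropy_pmf p - entropy_pmf (map_pmf snd p)"

definition msg_view :: "nat \<Rightarrow> nat \<Rightarrow> (nat \<times> nat \<Rightarrow> bool list) \<Rightarrow> nat set \<Rightarrow> (nat \<times> bool option list) pmf" where
  "msg_view k l code S =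
     do { m \<leftarrow> pmf_of_set (msgs k l);
          j \<leftarrow> pmf_of_set (keys l);
          return_pmf (m, view S (code (m, j))) }"

end

theory Submission
  imports Defs "HOL-Real_Asymp.Real_Asymp"
begin

text \<open>
  Call a code good if (a) for every set \<open>S\<close> of read positions, every view and every error \<open>e\<close>, at most
  \<open>\<delta> 2\<^sup>k / 2\<^bsup>card S\<^esup>\<close> codewords are consistent with the view and confusable under \<open>e\<close>, and
  (b) for every \<open>S\<close>, message and view, at most \<open>4 n\<close> keys produce that view. There are at most
  \<open>2\<^bsup>card S\<^esup>\<close> views, so (a) bounds the error probability by \<open>\<delta>\<close> for every adversary; (b) bounds
  the joint entropy of message and view from below by \<open>k - log (4 n)\<close>, while the entropy of the
  view is at most \<open>card S\<close>.

  A random code is good up to probability \<open>O(2\<^bsup>-n\<^esup>)\<close> by a union bound over the \<open>2\<^bsup>O(n)\<^esup>\<close> choices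
  of \<open>S\<close>, view, error and message, where each single failure is bounded by a \<open>t\<close>-th moment: one
  counts \<open>t\<close>-tuples of elementary events on disjoint sets of codewords, which are independent.
  For (a) these events are "\<open>p\<close> is consistent with the view and \<open>p'\<close> is confused with it". A single
  codeword takes part in boundedly many of them, because every Hamming ball of radius \<open>\<rho>w n\<close>
  contains boundedly many codewords, so disjoint tuples are plentiful; a constant \<open>t\<close> suffices
  since each confusion costs a factor \<open>2\<^bsup>-\<epsilon>n\<^esup>\<close>.
\<close>

section \<open>Vectors, Hamming balls and views\<close>

lemma finite_vecs [simp, intro]: "finite (vecs n)"
  using finite_lists_length_eq[of "UNIV :: bool set" n] by (simp add: vecs_def)

lemma card_vecs: "card (vecs n) = 2 ^ n"
  using card_lists_length_eq[of "UNIV :: bool set" n] by (simp add: vecs_def)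

lemma vecs_nonempty [simp]: "vecs n \<noteq> {}"
  using card_vecs[of n] by force

lemma in_vecs_iff: "x \<in> vecs n \<longleftrightarrow> length x = n"
  by (simp add: vecs_def)

lemma hweight_conv_card: "hweight e = card {i. i < length e \<and> e ! i}"
  by (simp add: hweight_def length_filter_conv_card)

lemma length_xorv [simp]: "length (xorv x y) = min (length x) (length y)"
  by (simp add: xorv_def)

lemma nth_xorv [simp]: "i < length x \<Longrightarrow> i < length y \<Longrightarrow> xorv x y ! i \<longleftrightarrow> x ! i \<noteq> y ! i"
  by (simp add: xorv_def)

lemma xorv_in_vecs: "x \<in> vecs n \<Longrightarrow> y \<in> vecs n \<Longrightarrow> xorv x y \<in> vecs n"
  by (simp add: in_vecs_iff)

lemma hdist_conv_hweight: "length x = length y \<Longrightarrow> hdist x y = hweight (xorv x y)"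
  unfolding hdist_def hweight_conv_card by (intro arg_cong[where f = card]) auto

lemma hdist_xorv_self: "length x = length e \<Longrightarrow> hdist x (xorv x e) = hweight e"
  unfolding hdist_def hweight_conv_card by (intro arg_cong[where f = card]) auto

lemma hdist_xorv_swap:
  "length x = length e \<Longrightarrow> length y = length e \<Longrightarrow> hdist x (xorv y e) = hdist y (xorv x e)"
  unfolding hdist_def by (intro arg_cong[where f = card]) auto

section \<open>Volume of Hamming balls of radius below half the length\<close>

definition hball :: "nat \<Rightarrow> real \<Rightarrow> bool list \<Rightarrow> bool list set" where
  "hball n r y = {x \<in> vecs n. real (hdist x y) \<le> r}"

lemma hball_subset: "hball n r y \<subseteq> vecs n"
  by (auto simp: hball_def)

lemma inj_on_xorv: "y \<in> vecs n \<Longrightarrow> inj_on (\<lambda>x. xorv x y) (vecs n)"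
proof (rule inj_onI)
  fix a b assume y: "y \<in> vecs n" and ab: "a \<in> vecs n" "b \<in> vecs n" "xorv a y = xorv b y"
  show "a = b"
  proof (rule nth_equalityI)
    show "length a = length b" using ab by (simp add: in_vecs_iff)
    fix i assume "i < length a"
    then have "xorv a y ! i = (a ! i \<noteq> y ! i)" "xorv b y ! i = (b ! i \<noteq> y ! i)"
      using y ab(1,2) by (simp_all add: in_vecs_iff)
    with ab(3) show "a ! i = b ! i" by auto
  qed
qed

lemma vecs_Suc: "vecs (Suc n) = (#) True ` vecs n \<union> (#) False ` vecs n"
proof -
  have "x \<in> (#) True ` vecs n \<union> (#) False ` vecs n" if "x \<in> vecs (Suc n)" for x
    using that by (cases x; cases "hd x") (auto simp: vecs_def)
  then show ?thesis by (auto simp: vecs_def)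
qed

text \<open>The binomial theorem, obtained by splitting off the first coordinate. For
  \<open>q = 1 - p\<close> it says that the product Bernoulli weights on \<open>vecs n\<close> have
  total mass one.\<close>

lemma sum_vecs_weight:
  fixes p q :: real
  shows "(\<Sum>x\<in>vecs n. p ^ hweight x * q ^ (n - hweight x)) = (p + q) ^ n"
proof (induction n)
  case 0
  have "vecs 0 = {[]}" by (auto simp: vecs_def)
  then show ?case by (simp add: hweight_def)
next
  case (Suc n)
  let ?f = "\<lambda>n x. p ^ hweight x * q ^ (n - hweight x)"
  have le: "hweight x \<le> n" if "x \<in> vecs n" for x
    using that length_filter_le[of id x] by (simp add: hweight_def vecs_def)
  have "(\<Sum>x\<in>vecs (Suc n). ?f (Suc n) x) =
      (\<Sum>x\<in>vecs n. ?f (Suc n) (True # x)) + (\<Sum>x\<in>vecs n. ?f (Suc n) (False # x))"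
    unfolding vecs_Suc by (subst sum.union_disjoint) (auto simp: sum.reindex)
  also have "\<dots> = (\<Sum>x\<in>vecs n. p * ?f n x) + (\<Sum>x\<in>vecs n. q * ?f n x)"
    by (intro arg_cong2[where f = "(+)"] sum.cong)
       (auto simp: hweight_def Suc_diff_le[OF le[unfolded hweight_def]])
  also have "\<dots> = (p + q) * (\<Sum>x\<in>vecs n. ?f n x)"
    by (simp add: sum_distrib_left distrib_right sum.distrib)
  finally show ?case by (simp add: Suc.IH)
qed

text \<open>Under the product Bernoulli measure with parameter \<open>p\<close>, every vector of
  weight at most \<open>p * n\<close> has mass at least \<open>2 powr (- bin_entropy p * n)\<close>,
  since for \<open>p < 1/2\<close> the mass decreases with the weight. The total mass is one, so
  there are few such vectors.\<close>

lemma card_low_weight: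
  assumes p: "0 < p" "p < 1/2"
  shows "real (card {e \<in> vecs n. real (hweight e) \<le> p * real n}) \<le> 2 powr (bin_entropy p * real n)"
proof -
  let ?W = "{e \<in> vecs n. real (hweight e) \<le> p * real n}"
  have lower: "2 powr (- bin_entropy p * real n) \<le> p ^ hweight e * (1 - p) ^ (n - hweight e)"
    if e: "e \<in> ?W" for e
  proof -
    let ?w = "hweight e"
    have w: "?w \<le> n"
      using e length_filter_le[of id e] by (simp add: hweight_def vecs_def)
    have "log 2 p \<le> log 2 (1 - p)" using p by simp
    \<comment> \<open>This product is exactly the difference between the exponent of the mass of
      \<open>e\<close> and the exponent at weight \<open>p * n\<close>.\<close>
    then have "0 \<le> (p * real n - real ?w) * (log 2 (1 - p) - log 2 p)"
      using e by simp
    then have "- bin_entropy p * real n \<le> log 2 p * real ?w + log 2 (1 - p) * real (n - ?w)"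
      unfolding bin_entropy_def using w by (simp add: algebra_simps of_nat_diff)
    then have "2 powr (- bin_entropy p * real n)
        \<le> 2 powr (log 2 p * real ?w + log 2 (1 - p) * real (n - ?w))"
      by simp
    also have "\<dots> = (2 powr log 2 p) powr real ?w * (2 powr log 2 (1 - p)) powr real (n - ?w)"
      by (simp only: powr_add powr_powr)
    also have "\<dots> = p ^ ?w * (1 - p) ^ (n - ?w)"
      using p by (simp add: powr_realpow)
    finally show ?thesis .
  qed
  have "real (card ?W) * 2 powr (- bin_entropy p * real n)
      \<le> (\<Sum>e\<in>?W. p ^ hweight e * (1 - p) ^ (n - hweight e))"
    using sum_bounded_below[of ?W, OF lower] by simp
  also have "\<dots> \<le> (\<Sum>e\<in>vecs n. p ^ hweight e * (1 - p) ^ (n - hweight e))"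
    using p by (intro sum_mono2) auto
  also have "\<dots> = 1" by (simp add: sum_vecs_weight)
  finally show ?thesis by (simp add: powr_minus field_simps)
qed

text \<open>Adding the centre \<open>y\<close> maps the ball injectively into the vectors of low
  weight.\<close>

lemma card_hball:
  assumes p: "0 < p" "p < 1/2" and y: "y \<in> vecs n"
  shows "real (card (hball n (p * real n) y)) \<le> 2 powr (bin_entropy p * real n)"
proof -
  let ?W = "{e \<in> vecs n. real (hweight e) \<le> p * real n}"
  have "card (hball n (p * real n) y) \<le> card ?W"
  proof (rule card_inj_on_le[where f = "\<lambda>x. xorv x y"])
    show "inj_on (\<lambda>x. xorv x y) (hball n (p * real n) y)"
      by (rule inj_on_subset[OF inj_on_xorv[OF y] hball_subset])
    show "(\<lambda>x. xorv x y) ` hball n (p * real n) y \<subseteq> ?W"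
      using y by (auto simp: hball_def in_vecs_iff hdist_conv_hweight)
  qed simp
  then show ?thesis using card_low_weight[OF p, of n] by linarith
qed

section \<open>Vectors that share a view, and the number of views\<close>

text \<open>A view is represented by any vector \<open>x0\<close> that produces it, so that later
  union bounds can range over \<open>vecs n\<close> instead of over views.\<close>

definition agreeing :: "nat \<Rightarrow> nat set \<Rightarrow> bool list \<Rightarrow> bool list set" where
  "agreeing n S x0 = {x \<in> vecs n. \<forall>i\<in>S. x ! i = x0 ! i}"

lemma finite_agreeing [simp, intro]: "finite (agreeing n S x0)"
  by (simp add: agreeing_def)

lemma agreeing_subset: "agreeing n S x0 \<subseteq> vecs n"
  by (auto simp: agreeing_def)

text \<open>Once the entries on \<open>S\<close> are prescribed, a vector is determined by its
  support outside \<open>S\<close>.\<close>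

lemma card_agreeing:
  assumes "S \<subseteq> {..<n}"
  shows "card (agreeing n S x0) \<le> 2 ^ (n - card S)"
proof -
  have "card (agreeing n S x0) \<le> card (Pow ({..<n} - S))"
  proof (rule card_inj_on_le[where f = "\<lambda>x. {i. i < n \<and> x ! i} - S"])
    show "inj_on (\<lambda>x. {i. i < n \<and> x ! i} - S) (agreeing n S x0)"
    proof (rule inj_onI)
      fix x y assume xy: "x \<in> agreeing n S x0" "y \<in> agreeing n S x0"
        and eq: "{i. i < n \<and> x ! i} - S = {i. i < n \<and> y ! i} - S"
      show "x = y"
      proof (rule nth_equalityI)
        show "length x = length y" using xy by (simp add: agreeing_def vecs_def)
        fix i assume "i < length x"
        then have "i < n" using xy by (simp add: agreeing_def vecs_def)
        then show "x ! i = y ! i" using xy eq by (cases "i \<in> S") (auto simp: agreeing_def)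
      qed
    qed
  qed auto
  also have "\<dots> = 2 ^ (n - card S)"
    using assms by (simp add: card_Pow card_Diff_subset finite_subset)
  finally show ?thesis .
qed

lemma nth_view:
  "S \<subseteq> {..<n} \<Longrightarrow> x \<in> vecs n \<Longrightarrow> i \<in> S \<Longrightarrow> view S x ! i = Some (x ! i)"
  using lessThan_iff[of i n] by (force simp: view_def vecs_def)

lemma view_eq_iff:
  assumes "S \<subseteq> {..<n}" "x \<in> vecs n" "y \<in> vecs n"
  shows "view S x = view S y \<longleftrightarrow> x \<in> agreeing n S y"
proof
  assume eq: "view S x = view S y"
  have "x ! i = y ! i" if "i \<in> S" for i
    using nth_view[OF assms(1,2) that] nth_view[OF assms(1,3) that] eq by simp
  then show "x \<in> agreeing n S y"
    using assms by (simp add: agreeing_def)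
next
  assume "x \<in> agreeing n S y"
  then show "view S x = view S y"
    using assms by (auto simp: view_def agreeing_def vecs_def)
qed

text \<open>The unread positions are the same in all views through \<open>S\<close>, so a view is
  determined by the read positions that show \<open>True\<close>.\<close>

lemma card_views:
  assumes S: "S \<subseteq> {..<n}" and X: "X \<subseteq> vecs n"
  shows "card (view S ` X) \<le> 2 ^ card S"
proof -
  have fS: "finite S" using S by (rule finite_subset) simp
  have "card (view S ` X) \<le> card (Pow S)"
  proof (rule card_inj_on_le[where f = "\<lambda>v. {i \<in> S. v ! i = Some True}"])
    show "inj_on (\<lambda>v. {i \<in> S. v ! i = Some True}) (view S ` X)"
    proof (rule inj_onI, safe)
      fix x y assume xy: "x \<in> X" "y \<in> X"
        and eq: "{i \<in> S. view S x ! i = Some True} = {i \<in> S. view S y ! i = Some True}"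
      have "x ! i = y ! i" if i: "i \<in> S" for i
      proof -
        have "view S x ! i = Some True \<longleftrightarrow> view S y ! i = Some True"
          using eq i by blast
        then show ?thesis
          using nth_view[OF S _ i] xy X by auto
      qed
      then have "x \<in> agreeing n S y"
        using xy X by (auto simp: agreeing_def)
      then show "view S x = view S y" using view_eq_iff[OF S] xy X by blast
    qed
  qed (use fS in auto)
  then show ?thesis using fS by (simp add: card_Pow)
qed

section \<open>A moment bound for events on disjoint coordinates\<close>

text \<open>Greedy choice: fewer than \<open>t\<close> earlier elements exclude at most
  \<open>t * D\<close> candidates, so at least \<open>s\<close> remain for each of the
  \<open>t\<close> positions.\<close>

lemma card_nonconflicting_lists:
  assumes fin: "finite A" and deg: "\<And>a. a \<in> A \<Longrightarrow> card {b \<in> A. R a b} \<le> D"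
    and card: "s + t * D \<le> card A"
  shows "s ^ t \<le> card {xs. set xs \<subseteq> A \<and> length xs = t \<and> sorted_wrt (\<lambda>a b. \<not> R b a) xs}"
proof -
  define L where "L j = {xs. set xs \<subseteq> A \<and> length xs = j \<and> sorted_wrt (\<lambda>a b. \<not> R b a) xs}" for j
  have finL: "finite (L j)" for j
    by (rule finite_subset[OF _ finite_lists_length_eq[OF fin, of j]]) (auto simp: L_def)
  have "s ^ j \<le> card (L j)" if "j \<le> t" for j
    using that
  proof (induction j)
    case 0
    have "L 0 = {[]}" by (auto simp: L_def)
    then show ?case by simp
  next
    case (Suc j)
    let ?G = "\<lambda>xs. A - (\<Union>a\<in>set xs. {b \<in> A. R a b})"
    have G: "s \<le> card (?G xs)" if xs: "xs \<in> L j" for xs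
    proof -
      have "card (\<Union>a\<in>set xs. {b \<in> A. R a b}) \<le> (\<Sum>a\<in>set xs. card {b \<in> A. R a b})"
        by (rule card_UN_le) simp
      also have "\<dots> \<le> card (set xs) * D"
        using xs sum_bounded_above[of "set xs" "\<lambda>a. card {b \<in> A. R a b}" D] deg
        by (auto simp: L_def subset_iff)
      also have "\<dots> \<le> t * D"
        using xs card_length[of xs] Suc.prems by (intro mult_right_mono) (auto simp: L_def)
      finally have "card (\<Union>a\<in>set xs. {b \<in> A. R a b}) \<le> t * D" .
      moreover have "card A - card (\<Union>a\<in>set xs. {b \<in> A. R a b}) \<le> card (?G xs)"
        using fin by (intro diff_card_le_card_Diff) auto
      ultimately show ?thesis using card by linarith
    qed
    have "s ^ Suc j \<le> s * card (L j)"
      using Suc by simp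
    also have "\<dots> \<le> (\<Sum>xs\<in>L j. card (?G xs))"
      using sum_bounded_below[of "L j" s "\<lambda>xs. card (?G xs)"] G by (simp add: mult.commute)
    also have "\<dots> = card (SIGMA xs:L j. ?G xs)"
      using finL fin by (simp add: card_SigmaI)
    also have "\<dots> \<le> card (L (Suc j))"
      \<comment> \<open>The newest element becomes the head. The degree bound concerns the earlier
        elements, which stand behind it; hence the order of arguments in
        \<open>R b a\<close>.\<close>
      by (rule card_inj_on_le[where f = "\<lambda>(xs, x). x # xs"])
         (use finL in \<open>auto simp: inj_on_def L_def\<close>)
    finally show ?case .
  qed
  then show ?thesis by (simp add: L_def)
qed

text \<open>Markov's inequality for a \<open>t\<close>-th moment. On \<open>Bad\<close> at least
  \<open>s ^ t\<close> conflict-free lists of length \<open>t\<close> have all their events occur,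
  while the expected number of such lists is at most \<open>card A ^ t * q ^ t\<close>. The witness
  \<open>A'\<close> may depend on the outcome.\<close>

lemma prob_many_events_le:
  fixes M :: "'w pmf" and Ev :: "'a \<Rightarrow> 'w set"
  assumes fin: "finite A" and s: "0 < s" and q: "0 \<le> q"
    and joint: "\<And>xs. set xs \<subseteq> A \<Longrightarrow> length xs = t \<Longrightarrow> sorted_wrt (\<lambda>a b. \<not> R b a) xs \<Longrightarrow>
      measure_pmf.prob M {\<omega>. \<forall>a\<in>set xs. \<omega> \<in> Ev a} \<le> q ^ t"
    and many: "\<And>\<omega>. \<omega> \<in> Bad \<Longrightarrow> \<exists>A' \<subseteq> A. (\<forall>a\<in>A'. \<omega> \<in> Ev a) \<and> s + t * D \<le> card A' \<and>
      (\<forall>a\<in>A'. card {b \<in> A'. R a b} \<le> D)"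
  shows "measure_pmf.prob M Bad \<le> (real (card A) * q / real s) ^ t"
proof -
  define L where "L = {xs. set xs \<subseteq> A \<and> length xs = t \<and> sorted_wrt (\<lambda>a b. \<not> R b a) xs}"
  define J where "J xs = {\<omega>. \<forall>a\<in>set xs. \<omega> \<in> Ev a}" for xs
  have Lsub: "L \<subseteq> {xs. set xs \<subseteq> A \<and> length xs = t}" by (auto simp: L_def)
  have finL: "finite L"
    by (rule finite_subset[OF Lsub finite_lists_length_eq[OF fin]])
  have ptw: "real s ^ t * indicator Bad \<omega> \<le> (\<Sum>xs\<in>L. indicator (J xs) \<omega>)" for \<omega>
  proof (cases "\<omega> \<in> Bad")
    case True
    then obtain A' where A': "A' \<subseteq> A" "\<forall>a\<in>A'. \<omega> \<in> Ev a" "s + t * D \<le> card A'"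
      "\<forall>a\<in>A'. card {b \<in> A'. R a b} \<le> D"
      using many[OF True] by (elim exE conjE) blast
    have "s ^ t \<le> card {xs. set xs \<subseteq> A' \<and> length xs = t \<and> sorted_wrt (\<lambda>a b. \<not> R b a) xs}"
      using A' fin by (intro card_nonconflicting_lists[of A' R D]) (auto intro: finite_subset)
    also have "\<dots> \<le> card {xs \<in> L. \<omega> \<in> J xs}"
      using A'(1,2) by (intro card_mono finite_subset[OF _ finL]) (auto simp: L_def J_def)
    also have "real (card {xs \<in> L. \<omega> \<in> J xs}) = (\<Sum>xs\<in>L. indicator (J xs) \<omega>)"
      using finL by (simp add: indicator_def of_bool_def flip: sum.inter_filter)
    finally show ?thesis using True by (simp flip: of_nat_power)
  qed (simp add: sum_nonneg)
  have int: "integrable (measure_pmf M) (indicator X :: 'w \<Rightarrow> real)" for X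
    by (rule measure_pmf.integrable_const_bound[where B = 1]) auto
  have "real s ^ t * measure_pmf.prob M Bad = measure_pmf.expectation M (\<lambda>\<omega>. real s ^ t * indicator Bad \<omega>)"
    by simp
  also have "\<dots> \<le> measure_pmf.expectation M (\<lambda>\<omega>. \<Sum>xs\<in>L. indicator (J xs) \<omega>)"
    by (rule integral_mono) (auto simp: ptw int intro!: Bochner_Integration.integrable_sum integrable_mult_right)
  also have "\<dots> = (\<Sum>xs\<in>L. measure_pmf.prob M (J xs))"
    by (subst Bochner_Integration.integral_sum) (auto simp: int)
  also have "\<dots> \<le> real (card L) * q ^ t"
    using joint by (intro sum_bounded_above) (auto simp: L_def J_def)
  also have "\<dots> \<le> real (card A ^ t) * q ^ t"
    using card_mono[OF finite_lists_length_eq[OF fin] Lsub] card_lists_length_eq[OF fin, of t] q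
    by (intro mult_right_mono) auto
  finally show ?thesis
    using s by (simp add: power_divide power_mult_distrib field_simps)
qed

lemma prob_Pi_pmf_of_set_box:
  assumes "finite P" "Q \<subseteq> P" "finite V" "V \<noteq> {}" "\<And>p. p \<in> Q \<Longrightarrow> W p \<subseteq> V"
  shows "measure_pmf.prob (Pi_pmf P d (\<lambda>_. pmf_of_set V)) {f. \<forall>p\<in>Q. f p \<in> W p} =
    (\<Prod>p\<in>Q. real (card (W p)) / real (card V))"
proof -
  let ?W = "\<lambda>p. if p \<in> Q then W p else UNIV"
  have "{f. \<forall>p\<in>Q. f p \<in> W p} = Pi P ?W"
    using assms(2) by (auto simp: Pi_def split: if_splits)
  then have "measure_pmf.prob (Pi_pmf P d (\<lambda>_. pmf_of_set V)) {f. \<forall>p\<in>Q. f p \<in> W p} =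
      (\<Prod>p\<in>P. measure_pmf.prob (pmf_of_set V) (?W p))"
    using assms(1) by (simp add: measure_Pi_pmf_Pi)
  also have "\<dots> = (\<Prod>p\<in>Q. measure_pmf.prob (pmf_of_set V) (W p))"
    using assms(1,2) by (intro prod.mono_neutral_cong_right) auto
  also have "\<dots> = (\<Prod>p\<in>Q. real (card (W p)) / real (card V))"
    using assms(3-5) by (intro prod.cong) (auto simp: measure_pmf_of_set Int_absorb1)
  finally show ?thesis .
qed

text \<open>Constraints on pairwise disjoint sets of coordinates merge into a single box, whose
  probability is the product over independent coordinates.\<close>

lemma prob_disjoint_boxes_le:
  assumes P: "finite P" and V: "finite V" "V \<noteq> {}"
    and box: "\<And>a. a \<in> set xs \<Longrightarrow> B a \<subseteq> P \<and> (\<forall>p\<in>B a. W a p \<subseteq> V) \<and>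
      (\<Prod>p\<in>B a. real (card (W a p)) / real (card V)) \<le> q"
    and disj: "sorted_wrt (\<lambda>a b. B b \<inter> B a = {}) xs"
  shows "measure_pmf.prob (Pi_pmf P d (\<lambda>_. pmf_of_set V))
    {f. \<forall>a\<in>set xs. \<forall>p\<in>B a. f p \<in> W a p} \<le> q ^ length xs"
proof -
  let ?v = "real (card V)"
  \<comment> \<open>\<open>G\<close> is the merged constraint: at a coordinate \<open>p\<close> it
    is \<open>W a p\<close> for the entry \<open>a\<close> whose set \<open>B a\<close> contains
    \<open>p\<close>.\<close>
  have "\<exists>G. (\<forall>f. (\<forall>a\<in>set xs. \<forall>p\<in>B a. f p \<in> W a p) \<longleftrightarrow> (\<forall>p\<in>\<Union>(B ` set xs). f p \<in> G p)) \<and>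
      (\<forall>p\<in>\<Union>(B ` set xs). G p \<subseteq> V) \<and>
      (\<Prod>p\<in>\<Union>(B ` set xs). real (card (G p)) / ?v) \<le> q ^ length xs"
    using box disj
  proof (induction xs)
    case (Cons x xs)
    then obtain G where G:
      "\<And>f. (\<forall>a\<in>set xs. \<forall>p\<in>B a. f p \<in> W a p) \<longleftrightarrow> (\<forall>p\<in>\<Union>(B ` set xs). f p \<in> G p)"
      "\<forall>p\<in>\<Union>(B ` set xs). G p \<subseteq> V"
      "(\<Prod>p\<in>\<Union>(B ` set xs). real (card (G p)) / ?v) \<le> q ^ length xs"
      by auto
    let ?G = "\<lambda>p. if p \<in> B x then W x p else G p"
    have x: "B x \<subseteq> P" "\<forall>p\<in>B x. W x p \<subseteq> V" "(\<Prod>p\<in>B x. real (card (W x p)) / ?v) \<le> q"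
      using Cons.prems(1)[of x] by auto
    have dx: "B x \<inter> \<Union>(B ` set xs) = {}"
      using Cons.prems(2) by auto
    have fins: "finite (B x)" "finite (\<Union>(B ` set xs))"
      using Cons.prems(1) finite_subset[OF _ P] by auto
    have "(\<Prod>p\<in>\<Union>(B ` set (x # xs)). real (card (?G p)) / ?v) =
        (\<Prod>p\<in>B x. real (card (?G p)) / ?v) * (\<Prod>p\<in>\<Union>(B ` set xs). real (card (?G p)) / ?v)"
      using fins dx by (simp add: prod.union_disjoint)
    also have "(\<Prod>p\<in>\<Union>(B ` set xs). real (card (?G p)) / ?v) =
        (\<Prod>p\<in>\<Union>(B ` set xs). real (card (G p)) / ?v)"
      using dx by (intro prod.cong) auto
    also have "(\<Prod>p\<in>B x. real (card (?G p)) / ?v) = (\<Prod>p\<in>B x. real (card (W x p)) / ?v)"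
      by (intro prod.cong) auto
    also have "\<dots> * (\<Prod>p\<in>\<Union>(B ` set xs). real (card (G p)) / ?v) \<le> q * q ^ length xs"
      using x(3) G(3) by (intro mult_mono order_trans[OF prod_nonneg x(3)] prod_nonneg) auto
    finally have 1: "(\<Prod>p\<in>\<Union>(B ` set (x # xs)). real (card (?G p)) / ?v) \<le> q ^ length (x # xs)"
      by simp
    have 2: "(\<forall>a\<in>set (x # xs). \<forall>p\<in>B a. f p \<in> W a p) \<longleftrightarrow>
        (\<forall>p\<in>\<Union>(B ` set (x # xs)). f p \<in> ?G p)" for f
      using G(1)[of f] dx by auto
    have 3: "\<forall>p\<in>\<Union>(B ` set (x # xs)). ?G p \<subseteq> V"
      using G(2) x(2) by auto
    show ?case
      by (rule exI[of _ ?G]) (intro conjI allI 1 2 3)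
  qed simp
  then obtain G where G:
      "\<And>f. (\<forall>a\<in>set xs. \<forall>p\<in>B a. f p \<in> W a p) \<longleftrightarrow> (\<forall>p\<in>\<Union>(B ` set xs). f p \<in> G p)"
      "\<forall>p\<in>\<Union>(B ` set xs). G p \<subseteq> V"
      "(\<Prod>p\<in>\<Union>(B ` set xs). real (card (G p)) / ?v) \<le> q ^ length xs"
    by (elim exE conjE) metis
  have "\<Union>(B ` set xs) \<subseteq> P" using box by (intro UN_least) simp
  then show ?thesis
    unfolding G(1) using prob_Pi_pmf_of_set_box[OF P _ V, of "\<Union>(B ` set xs)" G d] G(2,3) by simp
qed

text \<open>The form of the moment bound used for random codes: the event of \<open>a\<close>
  constrains the coordinates in \<open>B a\<close>, two events conflict when they share a
  coordinate, and conflict-free events are independent.\<close>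

lemma prob_many_boxes_le:
  assumes P: "finite P" and V: "finite V" "V \<noteq> {}" and A: "finite A" and s: "0 < s" and q: "0 \<le> q"
    and box: "\<And>a. a \<in> A \<Longrightarrow> B a \<subseteq> P \<and> (\<forall>p\<in>B a. W a p \<subseteq> V) \<and>
      (\<Prod>p\<in>B a. real (card (W a p)) / real (card V)) \<le> q"
    and many: "\<And>f. f \<in> Bad \<Longrightarrow> \<exists>A' \<subseteq> A. (\<forall>a\<in>A'. \<forall>p\<in>B a. f p \<in> W a p) \<and> s + t * D \<le> card A' \<and>
      (\<forall>a\<in>A'. card {b \<in> A'. B a \<inter> B b \<noteq> {}} \<le> D)"
  shows "measure_pmf.prob (Pi_pmf P d (\<lambda>_. pmf_of_set V)) Bad \<le> (real (card A) * q / real s) ^ t"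
proof (rule prob_many_events_le[OF A s q, where R = "\<lambda>a b. B a \<inter> B b \<noteq> {}"
      and Ev = "\<lambda>a. {f. \<forall>p\<in>B a. f p \<in> W a p}" and D = D])
  fix xs :: "'c list" assume xs: "set xs \<subseteq> A" "length xs = t" "sorted_wrt (\<lambda>a b. \<not> B b \<inter> B a \<noteq> {}) xs"
  show "measure_pmf.prob (Pi_pmf P d (\<lambda>_. pmf_of_set V))
      {f. \<forall>a\<in>set xs. f \<in> {f. \<forall>p\<in>B a. f p \<in> W a p}} \<le> q ^ t"
    using prob_disjoint_boxes_le[OF P V, of xs B W q d] box xs by auto
qed (use many in auto)

section \<open>Error probability and equivocation of a fixed code\<close>

lemma finite_msgs [simp]: "finite (msgs k l)"
  by (simp add: msgs_def)

lemma finite_keys [simp]: "finite (keys l)"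
  by (simp add: keys_def)

lemma card_msgs [simp]: "card (msgs k l) = 2 ^ (k - l)"
  by (simp add: msgs_def)

lemma card_keys [simp]: "card (keys l) = 2 ^ l"
  by (simp add: keys_def)

lemma msgs_nonempty [simp]: "msgs k l \<noteq> {}"
  by (simp add: msgs_def lessThan_empty_iff)

lemma keys_nonempty [simp]: "keys l \<noteq> {}"
  by (simp add: keys_def lessThan_empty_iff)

lemma card_msgs_keys: "l \<le> k \<Longrightarrow> card (msgs k l \<times> keys l) = 2 ^ k"
  by (simp add: card_cartesian_product flip: power_add)

text \<open>The decoder returns some minimiser of the distance. If its message is wrong, this
  minimiser is the required \<open>p'\<close>, however ties are broken.\<close>

lemma nn_decode_error:
  assumes "p \<in> msgs k l \<times> keys l" and "nn_decode k l code y \<noteq> fst p"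
  shows "\<exists>p'\<in>msgs k l \<times> keys l. p' \<noteq> p \<and> hdist (code p') y \<le> hdist (code p) y"
proof -
  let ?P = "msgs k l \<times> keys l" and ?f = "\<lambda>p. hdist (code p) y"
  have fin: "finite ?P" "?P \<noteq> {}" by auto
  have "arg_min_on ?f ?P \<noteq> p"
    using assms(2) by (auto simp: nn_decode_def)
  then show ?thesis
    using arg_min_if_finite(1)[OF fin, of ?f] arg_min_least[OF fin assms(1), of ?f]
    by (intro bexI[of _ "arg_min_on ?f ?P"]) simp_all
qed

lemma err_prob_eq:
  assumes "l \<le> k"
  shows "err_prob k l code S E = (\<Sum>p\<in>msgs k l \<times> keys l.
    measure_pmf.prob (E (view S (code p))) {e. nn_decode k l code (xorv (code p) e) \<noteq> fst p}) / 2 ^ k"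
proof -
  have inner: "measure_pmf.expectation (E v) (\<lambda>e. indicat_real {True} (Q e)) = measure_pmf.prob (E v) {e. Q e}"
    for v Q
  proof -
    have "indicat_real {True} (Q e) = indicator {e. Q e} e" for e by (simp add: indicator_def)
    then show ?thesis by simp
  qed
  have "(2::real) ^ k = 2 ^ (k - l) * 2 ^ l"
    using assms by (simp flip: power_add)
  then show ?thesis
    unfolding err_prob_def measure_pmf_single
    by (simp add: pmf_bind[of _ _ True] integral_pmf_of_set inner sum.cartesian_product
        sum_divide_distrib[symmetric] case_prod_unfold mult.commute)
qed

text \<open>Indices are compared, not messages or codewords. Repeated codewords and confusions
  between keys of one message may thus be counted as well, which only overestimates the decoding
  errors.\<close>

definition confusable ::
    "nat \<Rightarrow> real \<Rightarrow> 'i set \<Rightarrow> ('i \<Rightarrow> bool list) \<Rightarrow> bool list \<Rightarrow> 'i set" where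
  "confusable n r P code e =
    {p \<in> P. \<exists>p'\<in>P. p' \<noteq> p \<and> code p' \<in> hball n r (xorv (code p) e)}"

lemma err_prob_le:
  assumes lk: "l \<le> k" and adv: "adversary_ok n \<rho>r \<rho>w S E"
    and code: "\<And>p. p \<in> msgs k l \<times> keys l \<Longrightarrow> code p \<in> vecs n"
    and conf: "\<And>x0 e. x0 \<in> vecs n \<Longrightarrow> e \<in> vecs n \<Longrightarrow>
      real (card {p \<in> confusable n (\<rho>w * real n) (msgs k l \<times> keys l) code e. code p \<in> agreeing n S x0}) \<le> b"
  shows "err_prob k l code S E \<le> 2 ^ card S * b / 2 ^ k"
proof -
  let ?P = "msgs k l \<times> keys l"
  let ?fail = "\<lambda>p. {e. nn_decode k l code (xorv (code p) e) \<noteq> fst p}"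
  let ?V = "(\<lambda>p. view S (code p)) ` ?P"
  have S: "S \<subseteq> {..<n}" using adv by (simp add: adversary_ok_def)
  have fin: "finite ?P" by simp
  have b: "0 \<le> b" using conf[of "replicate n True" "replicate n True"] by (simp add: vecs_def)
  have each: "(\<Sum>p\<in>{p \<in> ?P. view S (code p) = v}. measure_pmf.prob (E (view S (code p))) (?fail p)) \<le> b"
    if v: "v \<in> ?V" for v
  proof -
    let ?X = "{p \<in> ?P. view S (code p) = v}"
    obtain p0 where p0: "p0 \<in> ?P" "v = view S (code p0)" using v by blast
    have finX: "finite ?X" using fin by simp
    have int: "integrable (measure_pmf (E v)) (indicator Y :: _ \<Rightarrow> real)" for Y
      by (rule measure_pmf.integrable_const_bound[where B = 1]) auto
    \<comment> \<open>All indices in \<open>?X\<close> face the same distribution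
      \<open>E v\<close>, so sum and expectation can be exchanged and it suffices to count failures
      for one fixed error.\<close>
    have pt: "(\<Sum>p\<in>?X. indicator (?fail p) e) \<le> b" if e: "e \<in> set_pmf (E v)" for e
    proof -
      have e': "e \<in> vecs n" "real (hweight e) \<le> \<rho>w * real n"
        using adv e by (auto simp: adversary_ok_def vecs_def)
      have "(\<Sum>p\<in>?X. indicator (?fail p) e) = real (card {p \<in> ?X. e \<in> ?fail p})"
        using finX by (simp add: indicator_def of_bool_def flip: sum.inter_filter)
      also have "\<dots> \<le> real (card {p \<in> confusable n (\<rho>w * real n) ?P code e. code p \<in> agreeing n S (code p0)})"
      proof (intro of_nat_mono card_mono subsetI)
        fix p assume "p \<in> {p \<in> ?X. e \<in> ?fail p}"
        then have p: "p \<in> ?P" "view S (code p) = v" "nn_decode k l code (xorv (code p) e) \<noteq> fst p"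
          by auto
        then obtain p' where p': "p' \<in> ?P" "p' \<noteq> p"
          "hdist (code p') (xorv (code p) e) \<le> hdist (code p) (xorv (code p) e)"
          using nn_decode_error by blast
        \<comment> \<open>The sent codeword lies within \<open>\<rho>w * n\<close> of the received
          word; the competitor is no farther away and hence in the same ball.\<close>
        have "hdist (code p) (xorv (code p) e) = hweight e"
          using code[OF p(1)] e' by (simp add: hdist_xorv_self vecs_def)
        then have "code p' \<in> hball n (\<rho>w * real n) (xorv (code p) e)"
          using p'(1,3) e' code by (auto simp: hball_def)
        moreover have "code p \<in> agreeing n S (code p0)"
          using view_eq_iff[OF S code[OF p(1)] code[OF p0(1)]] p(2) p0(2) by simp
        ultimately show "p \<in> {p \<in> confusable n (\<rho>w * real n) ?P code e. code p \<in> agreeing n S (code p0)}"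
          using p(1) p'(1,2) unfolding confusable_def by blast
      qed (use fin in \<open>auto simp: confusable_def\<close>)
      also have "\<dots> \<le> b" using conf code p0(1) e'(1) by blast
      finally show ?thesis .
    qed
    have "(\<Sum>p\<in>?X. measure_pmf.prob (E (view S (code p))) (?fail p)) =
        (\<Sum>p\<in>?X. measure_pmf.prob (E v) (?fail p))"
      by (intro sum.cong) auto
    also have "\<dots> = measure_pmf.expectation (E v) (\<lambda>e. \<Sum>p\<in>?X. indicator (?fail p) e)"
      by (subst Bochner_Integration.integral_sum) (auto simp: int)
    also have "\<dots> \<le> b"
      by (rule measure_pmf.integral_le_const)
         (auto simp: AE_measure_pmf_iff int pt intro!: Bochner_Integration.integrable_sum)
    finally show ?thesis .
  qed
  have "(\<Sum>p\<in>?P. measure_pmf.prob (E (view S (code p))) (?fail p)) =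
      (\<Sum>v\<in>?V. \<Sum>p\<in>{p \<in> ?P. view S (code p) = v}. measure_pmf.prob (E (view S (code p))) (?fail p))"
    by (rule sum.image_gen[OF fin])
  also have "\<dots> \<le> real (card ?V) * b"
    using each by (intro sum_bounded_above) auto
  also have "\<dots> \<le> 2 ^ card S * b"
  proof (rule mult_right_mono[OF _ b])
    have "card ?V \<le> 2 ^ card S"
      using card_views[OF S, of "code ` ?P"] code by (force simp: image_image)
    then show "real (card ?V) \<le> 2 ^ card S" by (simp flip: of_nat_le_iff)
  qed
  finally show ?thesis
    unfolding err_prob_eq[OF lk] by (intro divide_right_mono) simp_all
qed

section \<open>Entropy inequalities for finitely supported distributions\<close>

lemma entropy_pmf_expectation:
  "finite (set_pmf p) \<Longrightarrow> entropy_pmf p = - measure_pmf.expectation p (\<lambda>x. log 2 (pmf p x))"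
  by (subst integral_measure_pmf_real[of "set_pmf p"]) (auto simp: entropy_pmf_def mult.commute)

text \<open>Gibbs' inequality for weights \<open>q\<close> of total mass at most one, a consequence
  of \<open>ln x \<le> x - 1\<close>.\<close>

lemma entropy_pmf_le_cross_entropy:
  assumes fin: "finite (set_pmf p)" and q: "\<And>x. x \<in> set_pmf p \<Longrightarrow> 0 < q x"
    and sum: "(\<Sum>x\<in>set_pmf p. q x) \<le> 1"
  shows "entropy_pmf p \<le> - measure_pmf.expectation p (\<lambda>x. log 2 (q x))"
proof -
  have "(\<Sum>x\<in>set_pmf p. pmf p x * (ln (q x) - ln (pmf p x))) \<le> (\<Sum>x\<in>set_pmf p. q x - pmf p x)"
  proof (rule sum_mono)
    fix x assume x: "x \<in> set_pmf p"
    then have pos: "0 < pmf p x" by (rule pmf_positive)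
    have "ln (q x) - ln (pmf p x) \<le> q x / pmf p x - 1"
      using pos q[OF x] ln_le_minus_one[of "q x / pmf p x"] by (simp add: ln_div)
    then have "pmf p x * (ln (q x) - ln (pmf p x)) \<le> pmf p x * (q x / pmf p x - 1)"
      using pos by (intro mult_left_mono) auto
    also have "\<dots> = q x - pmf p x" using pos by (simp add: field_simps)
    finally show "pmf p x * (ln (q x) - ln (pmf p x)) \<le> q x - pmf p x" .
  qed
  also have "\<dots> \<le> 0"
    using sum sum_pmf_eq_1[OF fin order_refl] by (simp add: sum_subtractf)
  finally have "(\<Sum>x\<in>set_pmf p. pmf p x * (ln (q x) - ln (pmf p x))) / ln 2 \<le> 0"
    by (simp add: divide_le_0_iff)
  moreover have "(\<Sum>x\<in>set_pmf p. pmf p x * (ln (q x) - ln (pmf p x))) / ln 2 =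
      (\<Sum>x\<in>set_pmf p. log 2 (q x) * pmf p x) - (\<Sum>x\<in>set_pmf p. pmf p x * log 2 (pmf p x))"
    by (simp add: log_def sum_divide_distrib diff_divide_distrib right_diff_distrib mult.commute
        flip: sum_subtractf)
  ultimately show ?thesis
    using integral_measure_pmf_real[OF fin, of p "\<lambda>x. log 2 (q x)"]
    by (simp add: entropy_pmf_def)
qed

lemma entropy_pmf_le_log_card:
  assumes "finite X" "set_pmf p \<subseteq> X"
  shows "entropy_pmf p \<le> log 2 (card X)"
proof -
  have fin: "finite (set_pmf p)" using assms finite_subset by blast
  have "X \<noteq> {}" using assms(2) set_pmf_not_empty[of p] by auto
  then have X: "0 < card X" using assms(1) by (simp add: card_gt_0_iff)
  have "card (set_pmf p) \<le> card X" using assms card_mono by blast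
  then have "entropy_pmf p \<le> - measure_pmf.expectation p (\<lambda>x. log 2 (1 / real (card X)))"
    using X by (intro entropy_pmf_le_cross_entropy[OF fin]) auto
  also have "\<dots> = log 2 (card X)" using X by (simp add: log_divide)
  finally show ?thesis .
qed

text \<open>Entropy is at least min-entropy.\<close>

lemma entropy_pmf_ge:
  assumes fin: "finite (set_pmf p)" and le: "\<And>x. x \<in> set_pmf p \<Longrightarrow> pmf p x \<le> c"
  shows "- log 2 c \<le> entropy_pmf p"
proof -
  have "log 2 (pmf p x) \<le> log 2 c" if "x \<in> set_pmf p" for x
    using le[OF that] pmf_positive[OF that] by simp
  then have "measure_pmf.expectation p (\<lambda>x. log 2 (pmf p x)) \<le> log 2 c"
    by (intro measure_pmf.integral_le_const integrable_measure_pmf_finite fin)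
       (auto simp: AE_measure_pmf_iff)
  then show ?thesis by (simp add: entropy_pmf_expectation[OF fin])
qed

text \<open>Gibbs' inequality against the product of the uniform distribution on \<open>A\<close>
  and the second marginal. The cross entropy is then \<open>log 2 (card A)\<close> plus the entropy
  of that marginal.\<close>

lemma cond_entropy_pmf_le_log_card:
  fixes p :: "('a \<times> 'b) pmf"
  assumes fin: "finite (set_pmf p)" and A: "finite A" "fst ` set_pmf p \<subseteq> A"
  shows "cond_entropy_pmf p \<le> log 2 (card A)"
proof -
  let ?r = "map_pmf snd p"
  let ?q = "\<lambda>x. pmf ?r (snd x) / real (card A)"
  have "A \<noteq> {}" using A(2) set_pmf_not_empty[of p] by auto
  then have cA: "0 < card A" using A(1) by (simp add: card_gt_0_iff)
  have finr: "finite (set_pmf ?r)" using fin by simp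
  have r: "0 < pmf ?r (snd x)" if "x \<in> set_pmf p" for x
    using that by (intro pmf_positive) auto
  have "(\<Sum>x\<in>set_pmf p. ?q x) \<le> (\<Sum>x\<in>A \<times> set_pmf ?r. ?q x)"
    using A finr by (intro sum_mono2) force+
  also have "\<dots> = (\<Sum>a\<in>A. \<Sum>v\<in>set_pmf ?r. pmf ?r v / real (card A))"
    by (subst sum.cartesian_product) (simp add: case_prod_unfold)
  also have "\<dots> = 1"
    using cA sum_pmf_eq_1[OF finr order_refl] by (simp flip: sum_divide_distrib)
  finally have "entropy_pmf p \<le> - measure_pmf.expectation p (\<lambda>x. log 2 (?q x))"
    using r cA by (intro entropy_pmf_le_cross_entropy[OF fin]) auto
  also have "measure_pmf.expectation p (\<lambda>x. log 2 (?q x)) =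
      measure_pmf.expectation p (\<lambda>x. log 2 (pmf ?r (snd x)) - log 2 (card A))"
  proof (intro integral_cong_AE AE_pmfI)
    fix x assume "x \<in> set_pmf p"
    then show "log 2 (?q x) = log 2 (pmf ?r (snd x)) - log 2 (card A)"
      using r[of x] cA by (simp add: log_divide)
  qed auto
  also have "\<dots> = measure_pmf.expectation p (\<lambda>x. log 2 (pmf ?r (snd x))) - log 2 (card A)"
    using fin by (subst Bochner_Integration.integral_diff) (auto intro: integrable_measure_pmf_finite)
  also have "measure_pmf.expectation p (\<lambda>x. log 2 (pmf ?r (snd x))) = - entropy_pmf ?r"
    by (simp add: entropy_pmf_expectation[OF finr] del: set_map_pmf)
  finally show ?thesis by (simp add: cond_entropy_pmf_def)
qed

section \<open>The joint distribution of message and view\<close>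

lemma set_pmf_msg_view:
  "set_pmf (msg_view k l code S) = (\<lambda>(m, j). (m, view S (code (m, j)))) ` (msgs k l \<times> keys l)"
  by (auto simp: msg_view_def set_pmf_of_set)

lemma pmf_msg_view:
  assumes "l \<le> k" "m \<in> msgs k l"
  shows "pmf (msg_view k l code S) (m, v) = real (card {j \<in> keys l. view S (code (m, j)) = v}) / 2 ^ k"
proof -
  have k: "(2::real) ^ k = 2 ^ (k - l) * 2 ^ l"
    using assms by (simp flip: power_add)
  have inner: "(\<Sum>j\<in>keys l. indicat_real {(m, v)} (m', view S (code (m', j)))) =
      (if m' = m then real (card {j \<in> keys l. view S (code (m, j)) = v}) else 0)" for m'
    by (simp add: indicator_def of_bool_def flip: sum.inter_filter)
  show ?thesis
    unfolding msg_view_def using assms(2)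
    by (simp add: pmf_bind integral_pmf_of_set inner k sum.delta' flip: sum_divide_distrib)
qed

text \<open>The upper bound is the logarithm of the number of messages. For the lower bound, each
  pair of message and view has mass at most \<open>b / 2 ^ k\<close>, so the joint entropy is at
  least \<open>k - log 2 b\<close>; the view accounts for at most \<open>card S\<close> bits of
  it.\<close>

lemma cond_entropy_msg_view_bounds:
  assumes lk: "l \<le> k" and S: "S \<subseteq> {..<n}" and b: "0 < b"
    and code: "\<And>p. p \<in> msgs k l \<times> keys l \<Longrightarrow> code p \<in> vecs n"
    and few: "\<And>m x0. m \<in> msgs k l \<Longrightarrow> x0 \<in> vecs n \<Longrightarrow>
      real (card {j \<in> keys l. code (m, j) \<in> agreeing n S x0}) \<le> b"
  shows "cond_entropy_pmf (msg_view k l code S) \<le> real (k - l)"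
    and "real k - real (card S) - log 2 b \<le> cond_entropy_pmf (msg_view k l code S)"
proof -
  let ?p = "msg_view k l code S"
  have fin: "finite (set_pmf ?p)" by (simp add: set_pmf_msg_view)
  have "cond_entropy_pmf ?p \<le> log 2 (card (msgs k l))"
    by (rule cond_entropy_pmf_le_log_card[OF fin]) (auto simp: set_pmf_msg_view)
  then show "cond_entropy_pmf ?p \<le> real (k - l)" by simp
  have "pmf ?p x \<le> b / 2 ^ k" if "x \<in> set_pmf ?p" for x
  proof -
    obtain m j where x: "x = (m, view S (code (m, j)))" "m \<in> msgs k l" "j \<in> keys l"
      using \<open>x \<in> set_pmf ?p\<close> by (auto simp: set_pmf_msg_view)
    have "{j' \<in> keys l. view S (code (m, j')) = view S (code (m, j))} =
        {j' \<in> keys l. code (m, j') \<in> agreeing n S (code (m, j))}"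
      using x code by (intro Collect_cong conj_cong view_eq_iff[OF S]) auto
    then show ?thesis
      using few[OF x(2) code[of "(m, j)"]] x by (simp add: pmf_msg_view[OF lk] divide_right_mono)
  qed
  then have "- log 2 (b / 2 ^ k) \<le> entropy_pmf ?p" by (rule entropy_pmf_ge[OF fin])
  then have "real k - log 2 b \<le> entropy_pmf ?p" using b by (simp add: log_divide log_nat_power)
  moreover have "entropy_pmf (map_pmf snd ?p) \<le> real (card S)"
  proof -
    let ?V = "view S ` code ` (msgs k l \<times> keys l)"
    have "entropy_pmf (map_pmf snd ?p) \<le> log 2 (card ?V)"
      by (rule entropy_pmf_le_log_card) (auto simp: set_pmf_msg_view)
    also have "\<dots> \<le> log 2 (2 ^ card S)"
    proof (subst log_le_cancel_iff)
      have "?V \<noteq> {}" by simp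
      then show "0 < real (card ?V)" by (simp add: card_gt_0_iff)
      have "card ?V \<le> 2 ^ card S" using code by (intro card_views[OF S]) auto
      then show "real (card ?V) \<le> 2 ^ card S" by (simp flip: of_nat_le_iff)
    qed auto
    finally show ?thesis by simp
  qed
  ultimately show "real k - real (card S) - log 2 b \<le> cond_entropy_pmf ?p"
    by (simp add: cond_entropy_pmf_def)
qed

section \<open>Random codes are good\<close>

text \<open>Moment bound with one-coordinate events. Such an event conflicts only with itself, so
  \<open>D = 1\<close> and the threshold \<open>2 * T\<close> splits as \<open>s + t * D\<close>
  with \<open>s = t = T\<close>.\<close>

lemma prob_crowded_ball_le:
  fixes P :: "'i set"
  assumes P: "finite P" and T: "0 < T" and q: "real (card (hball n r y)) / 2 ^ n \<le> q"
  shows "measure_pmf.prob (Pi_pmf P d (\<lambda>_. pmf_of_set (vecs n)))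
    {code. 2 * T \<le> card {p \<in> P. code p \<in> hball n r y}} \<le> (real (card P) * q) ^ T"
proof -
  have q0: "0 \<le> q" using q by (rule order_trans[rotated]) simp
  have "measure_pmf.prob (Pi_pmf P d (\<lambda>_. pmf_of_set (vecs n)))
      {code. 2 * T \<le> card {p \<in> P. code p \<in> hball n r y}} \<le> (real (card P) * q / real T) ^ T"
  proof (rule prob_many_boxes_le[OF P finite_vecs vecs_nonempty P T q0,
        where B = "\<lambda>p. {p}" and W = "\<lambda>_ _. hball n r y" and D = 1])
    fix code :: "'i \<Rightarrow> bool list"
    let ?C = "{p \<in> P. code p \<in> hball n r y}"
    assume "code \<in> {code. 2 * T \<le> card {p \<in> P. code p \<in> hball n r y}}"
    moreover have "card {b \<in> ?C. {a} \<inter> {b} \<noteq> {}} \<le> 1" if "a \<in> ?C" for a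
    proof -
      have "{b \<in> ?C. {a} \<inter> {b} \<noteq> {}} = {a}" using that by auto
      then show ?thesis by simp
    qed
    ultimately show "\<exists>A'\<subseteq>P. (\<forall>a\<in>A'. \<forall>p\<in>{a}. code p \<in> hball n r y) \<and> T + T * 1 \<le> card A' \<and>
        (\<forall>a\<in>A'. card {b \<in> A'. {a} \<inter> {b} \<noteq> {}} \<le> 1)"
      by (intro exI[of _ ?C]) auto
  qed (use q hball_subset in \<open>auto simp: card_vecs\<close>)
  also have "\<dots> \<le> (real (card P) * q) ^ T"
  proof (rule power_mono)
    have "0 \<le> real (card P) * q" using q0 by simp
    then show "real (card P) * q / real T \<le> real (card P) * q"
      using T mult_left_mono[of 1 "real T" "real (card P) * q"] by (simp add: divide_le_eq)
  qed (use q0 in simp)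
  finally show ?thesis .
qed

text \<open>Moment bound with \<open>s = 1\<close> and \<open>D = 1\<close>. The condition
  \<open>l < card S\<close> makes the expected number of agreeing keys at most
  \<open>1 / 2\<close>.\<close>

lemma prob_many_keys_agree_le:
  assumes S: "S \<subseteq> {..<n}" and l: "l < card S" and m: "m \<in> msgs k l"
  shows "measure_pmf.prob (random_code n k l)
    {code. t < card {j \<in> keys l. code (m, j) \<in> agreeing n S x0}} \<le> (1 / 2) ^ t"
proof -
  have cS: "card S \<le> n" using card_mono[OF _ S] by simp
  have q: "real (card (agreeing n S x0)) / 2 ^ n \<le> 1 / 2 ^ card S"
  proof -
    have "real (card (agreeing n S x0)) \<le> 2 ^ (n - card S)"
      using card_agreeing[OF S, of x0] by (simp flip: of_nat_le_iff)
    also have "\<dots> = 2 ^ n / 2 ^ card S" using cS by (simp add: power_diff)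
    finally show ?thesis by (simp add: field_simps)
  qed
  have "measure_pmf.prob (random_code n k l)
      {code. t < card {j \<in> keys l. code (m, j) \<in> agreeing n S x0}}
      \<le> (real (card (keys l)) * (1 / 2 ^ card S) / real 1) ^ t"
    unfolding random_code_def
  proof (rule prob_many_boxes_le[OF _ finite_vecs vecs_nonempty,
        where B = "\<lambda>j. {(m, j)}" and W = "\<lambda>_ _. agreeing n S x0" and D = 1])
    fix code :: "nat \<times> nat \<Rightarrow> bool list"
    let ?C = "{j \<in> keys l. code (m, j) \<in> agreeing n S x0}"
    assume "code \<in> {code. t < card {j \<in> keys l. code (m, j) \<in> agreeing n S x0}}"
    moreover have "card {b \<in> ?C. {(m, a)} \<inter> {(m, b)} \<noteq> {}} \<le> 1" if "a \<in> ?C" for a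
    proof -
      have "{b \<in> ?C. {(m, a)} \<inter> {(m, b)} \<noteq> {}} = {a}" using that by auto
      then show ?thesis by simp
    qed
    ultimately show "\<exists>A'\<subseteq>keys l. (\<forall>a\<in>A'. \<forall>p\<in>{(m, a)}. code p \<in> agreeing n S x0) \<and>
        1 + t * 1 \<le> card A' \<and> (\<forall>a\<in>A'. card {b \<in> A'. {(m, a)} \<inter> {(m, b)} \<noteq> {}} \<le> 1)"
      by (intro exI[of _ ?C]) auto
  qed (use q m agreeing_subset in \<open>auto simp: card_vecs\<close>)
  also have "\<dots> \<le> (1 / 2) ^ t"
  proof (rule power_mono)
    have "(2::real) ^ Suc l \<le> 2 ^ card S" using l by (intro power_increasing) auto
    then show "real (card (keys l)) * (1 / 2 ^ card S) / real 1 \<le> 1 / 2" by (simp add: field_simps)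
  qed simp
  finally show ?thesis .
qed

text \<open>The elementary event of a triple \<open>(p, x, p')\<close> is that \<open>code p\<close>
  equals \<open>x\<close> and \<open>code p'\<close> lies in the ball around
  \<open>xorv x e\<close>. Fixing \<open>x\<close> makes the ball deterministic, so this is a box on
  two coordinates of probability at most \<open>q / 2 ^ n\<close>. The sparsity condition in the
  event limits the conflicts between triples.\<close>

lemma prob_many_confusable_le:
  fixes P :: "'i set"
  assumes P: "finite P" and S: "S \<subseteq> {..<n}" and e: "e \<in> vecs n" and u: "0 < u"
    and q: "\<And>y. y \<in> vecs n \<Longrightarrow> real (card (hball n r y)) / 2 ^ n \<le> q"
  shows "measure_pmf.prob (Pi_pmf P dflt (\<lambda>_. pmf_of_set (vecs n)))
    {code. (\<forall>p\<in>P. code p \<in> vecs n) \<and>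
      (\<forall>y\<in>vecs n. card {p \<in> P. code p \<in> hball n r y} \<le> d) \<and>
      u + t * (2 + 2 * d) \<le> card {p \<in> confusable n r P code e. code p \<in> agreeing n S x0}}
    \<le> (real (card P) / 2 ^ card S * (real (card P) * q) / real u) ^ t"
proof -
  let ?A = "{(p, x, p') \<in> P \<times> agreeing n S x0 \<times> P. p \<noteq> p'}"
  let ?B = "\<lambda>(p :: 'i, x :: bool list, p' :: 'i). {p, p'}"
  let ?W = "\<lambda>(p :: 'i, x, p' :: 'i) z. if z = p then {x} else hball n r (xorv x e)"
  have cS: "card S \<le> n" using card_mono[OF _ S] by simp
  have "replicate n True \<in> vecs n" by (simp add: vecs_def)
  then have q0: "0 \<le> q" using q by (meson divide_nonneg_nonneg of_nat_0_le_iff order_trans zero_le_numeral zero_le_power)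
  have finA: "finite ?A"
    using P by (auto intro: finite_subset[of _ "P \<times> agreeing n S x0 \<times> P"])
  have cardA: "real (card ?A) * (1 / 2 ^ n * q) \<le> real (card P) / 2 ^ card S * (real (card P) * q)"
  proof -
    have "card ?A \<le> card (P \<times> agreeing n S x0 \<times> P)"
      using P by (intro card_mono) auto
    also have "\<dots> \<le> card P * (2 ^ (n - card S) * card P)"
      using card_agreeing[OF S, of x0] by (simp add: card_cartesian_product)
    finally have "real (card ?A) \<le> real (card P * (2 ^ (n - card S) * card P))"
      by (simp only: of_nat_le_iff)
    also have "\<dots> = real (card P) * ((2::real) ^ (n - card S) * real (card P))" by simp
    also have "\<dots> = real (card P) * (2 ^ n / 2 ^ card S * real (card P))"
      using cS by (simp only: power_diff)
    finally have "real (card ?A) * (1 / 2 ^ n * q) \<le>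
        real (card P) * (2 ^ n / 2 ^ card S * real (card P)) * (1 / 2 ^ n * q)"
      using q0 by (intro mult_right_mono) auto
    then show ?thesis by (simp add: field_simps)
  qed
  have "measure_pmf.prob (Pi_pmf P dflt (\<lambda>_. pmf_of_set (vecs n)))
    {code. (\<forall>p\<in>P. code p \<in> vecs n) \<and>
      (\<forall>y\<in>vecs n. card {p \<in> P. code p \<in> hball n r y} \<le> d) \<and>
      u + t * (2 + 2 * d) \<le> card {p \<in> confusable n r P code e. code p \<in> agreeing n S x0}}
    \<le> (real (card ?A) * (1 / 2 ^ n * q) / real u) ^ t"
  proof (rule prob_many_boxes_le[OF P finite_vecs vecs_nonempty finA u,
        where B = ?B and W = ?W and D = "2 + 2 * d"])
    show "0 \<le> 1 / 2 ^ n * q" using q0 by simp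
  next
    fix a assume "a \<in> ?A"
    then obtain p x p' where a: "a = (p, x, p')" "p \<in> P" "p' \<in> P" "x \<in> agreeing n S x0" "p \<noteq> p'"
      by auto
    then have x: "x \<in> vecs n" using agreeing_subset by blast
    have "(\<Prod>z\<in>?B a. real (card (?W a z)) / real (card (vecs n))) =
        1 / 2 ^ n * (real (card (hball n r (xorv x e))) / 2 ^ n)"
      using a by (auto simp: card_vecs)
    also have "\<dots> \<le> 1 / 2 ^ n * q"
      using q[OF xorv_in_vecs[OF x e]] by (intro mult_left_mono) auto
    finally show "?B a \<subseteq> P \<and> (\<forall>z\<in>?B a. ?W a z \<subseteq> vecs n) \<and>
        (\<Prod>z\<in>?B a. real (card (?W a z)) / real (card (vecs n))) \<le> 1 / 2 ^ n * q"
      using a x hball_subset by auto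
  next
    fix code :: "'i \<Rightarrow> bool list"
    let ?C = "{p \<in> confusable n r P code e. code p \<in> agreeing n S x0}"
    assume "code \<in> {code. (\<forall>p\<in>P. code p \<in> vecs n) \<and>
      (\<forall>y\<in>vecs n. card {p \<in> P. code p \<in> hball n r y} \<le> d) \<and>
      u + t * (2 + 2 * d) \<le> card {p \<in> confusable n r P code e. code p \<in> agreeing n S x0}}"
    then have code: "\<And>p. p \<in> P \<Longrightarrow> code p \<in> vecs n"
      and sparse: "\<And>y. y \<in> vecs n \<Longrightarrow> card {p \<in> P. code p \<in> hball n r y} \<le> d"
      and many: "u + t * (2 + 2 * d) \<le> card ?C"
      by auto
    have "\<forall>p\<in>?C. \<exists>p'. p' \<in> P \<and> p' \<noteq> p \<and> code p' \<in> hball n r (xorv (code p) e)"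
      by (auto simp: confusable_def)
    then obtain f where f: "\<And>p. p \<in> ?C \<Longrightarrow> f p \<in> P \<and> f p \<noteq> p \<and> code (f p) \<in> hball n r (xorv (code p) e)"
      by metis
    let ?g = "\<lambda>p. (p, code p, f p)"
    have CP: "?C \<subseteq> P" by (auto simp: confusable_def)
    then have finC: "finite ?C" using P by (rule finite_subset)
    \<comment> \<open>Confusion is symmetric: if \<open>code z\<close> is in the ball around
      \<open>code p\<close> shifted by \<open>e\<close>, then \<open>code p\<close> is in the ball
      around \<open>code z\<close> shifted by \<open>e\<close>. Sparsity of that ball limits how
      many \<open>p\<close> share the partner \<open>z\<close>.\<close>
    have fibre: "card {p \<in> ?C. f p = z} \<le> d" if z: "z \<in> P" for z
    proof -
      have "{p \<in> ?C. f p = z} \<subseteq> {p \<in> P. code p \<in> hball n r (xorv (code z) e)}"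
      proof
        fix p assume p: "p \<in> {p \<in> ?C. f p = z}"
        then have pP: "p \<in> P" and "code z \<in> hball n r (xorv (code p) e)"
          using f CP by blast+
        moreover have "hdist (code z) (xorv (code p) e) = hdist (code p) (xorv (code z) e)"
          using code[OF z] code[OF pP] e by (intro hdist_xorv_swap) (auto simp: vecs_def)
        ultimately show "p \<in> {p \<in> P. code p \<in> hball n r (xorv (code z) e)}"
          using code by (simp add: hball_def)
      qed
      then have "card {p \<in> ?C. f p = z} \<le> card {p \<in> P. code p \<in> hball n r (xorv (code z) e)}"
        using P by (intro card_mono) auto
      also have "\<dots> \<le> d" using sparse xorv_in_vecs[OF code[OF z] e] by blast
      finally show ?thesis .
    qed
    \<comment> \<open>A triple that meets \<open>{p, f p}\<close> either starts at one of these two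
      indices or has one of them as partner; the latter happens at most \<open>d\<close> times for
      each.\<close>
    have deg: "card {b \<in> ?g ` ?C. ?B (?g p) \<inter> ?B b \<noteq> {}} \<le> 2 + 2 * d" if p: "p \<in> ?C" for p
    proof -
      let ?N = "{p, f p} \<union> ({p' \<in> ?C. f p' = p} \<union> {p' \<in> ?C. f p' = f p})"
      have "{b \<in> ?g ` ?C. ?B (?g p) \<inter> ?B b \<noteq> {}} \<subseteq> ?g ` ?N"
        by auto
      moreover have "finite ?N"
        using finC by (rule finite_subset[rotated, OF finite.insertI[OF finite.insertI]]) auto
      ultimately have "card {b \<in> ?g ` ?C. ?B (?g p) \<inter> ?B b \<noteq> {}} \<le> card ?N"
        by (meson card_image_le card_mono finite_imageI le_trans)
      also have "\<dots> \<le> card {p, f p} + (card {p' \<in> ?C. f p' = p} + card {p' \<in> ?C. f p' = f p})"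
        by (intro order_trans[OF card_Un_le] add_mono card_Un_le order_refl)
      also have "\<dots> \<le> 2 + (d + d)"
        using fibre[of p] fibre[of "f p"] f[OF p] p CP by (intro add_mono) (auto simp: card_insert_if)
      finally show ?thesis by simp
    qed
    have "card (?g ` ?C) = card ?C" by (intro card_image) (auto simp: inj_on_def)
    then have "u + t * (2 + 2 * d) \<le> card (?g ` ?C)" using many by simp
    moreover have "?g p \<in> ?A" if p: "p \<in> ?C" for p
      using f[OF p] p CP by (auto simp: eq_commute[of p "f p"])
    then have "?g ` ?C \<subseteq> ?A" by (rule image_subsetI)
    moreover have "\<forall>a\<in>?g ` ?C. \<forall>z\<in>?B a. code z \<in> ?W a z" using f by auto
    ultimately show "\<exists>A'\<subseteq>?A. (\<forall>a\<in>A'. \<forall>z\<in>?B a. code z \<in> ?W a z) \<and>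
        u + t * (2 + 2 * d) \<le> card A' \<and> (\<forall>a\<in>A'. card {b \<in> A'. ?B a \<inter> ?B b \<noteq> {}} \<le> 2 + 2 * d)"
      using deg by (intro exI[of _ "?g ` ?C"] conjI) blast+
  qed
  also have "\<dots> \<le> (real (card P) / 2 ^ card S * (real (card P) * q) / real u) ^ t"
    using cardA q0 by (intro power_mono divide_right_mono) auto
  finally show ?thesis .
qed

lemma prob_UN_le:
  assumes "finite I" "\<And>i. i \<in> I \<Longrightarrow> measure_pmf.prob M (X i) \<le> b" "real (card I) \<le> c" "0 \<le> b"
  shows "measure_pmf.prob M (\<Union>i\<in>I. X i) \<le> c * b"
proof -
  have "measure_pmf.prob M (\<Union>i\<in>I. X i) \<le> (\<Sum>i\<in>I. measure_pmf.prob M (X i))"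
    using assms(1) by (intro measure_UNION_le) auto
  also have "\<dots> \<le> real (card I) * b"
    using assms(2) by (intro sum_bounded_above) auto
  also have "\<dots> \<le> c * b" using assms(3,4) by (rule mult_right_mono)
  finally show ?thesis .
qed

text \<open>Union bound over three kinds of failure: a crowded ball (\<open>2 ^ n\<close> centres),
  too many confusable codewords for some \<open>(S, x0, e)\<close>, and too many agreeing keys for
  some \<open>(S, m, x0)\<close> (at most \<open>2 ^ (3 * n)\<close> triples each). The threshold
  \<open>4 * n\<close> makes the last failure rare enough to beat this count.\<close>

lemma prob_good_code_ge:
  assumes lk: "l \<le> k" and kn: "k \<le> n" and l: "l < \<sigma>" and T: "0 < T" and u: "0 < u"
    and q: "\<And>y. y \<in> vecs n \<Longrightarrow> real (card (hball n r y)) / 2 ^ n \<le> q"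
  defines "P \<equiv> msgs k l \<times> keys l"
  shows "1 - (2 ^ n * (2 ^ k * q) ^ T + 2 ^ (3 * n) * (2 ^ k / 2 ^ \<sigma> * (2 ^ k * q) / real u) ^ t
      + 2 ^ (3 * n) * (1 / 2) ^ (4 * n)) \<le>
    measure_pmf.prob (random_code n k l) {code. (\<forall>p\<in>P. code p \<in> vecs n) \<and>
      (\<forall>S x0 e. S \<subseteq> {..<n} \<and> card S = \<sigma> \<and> x0 \<in> vecs n \<and> e \<in> vecs n \<longrightarrow>
        card {p \<in> confusable n r P code e. code p \<in> agreeing n S x0} < u + t * (2 + 4 * T)) \<and>
      (\<forall>S m x0. S \<subseteq> {..<n} \<and> card S = \<sigma> \<and> m \<in> msgs k l \<and> x0 \<in> vecs n \<longrightarrow>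
        card {j \<in> keys l. code (m, j) \<in> agreeing n S x0} \<le> 4 * n)}"
    (is "1 - (?b1 + ?b2 + ?b3) \<le> measure_pmf.prob ?M ?G")
proof -
  let ?F = "{S. S \<subseteq> {..<n} \<and> card S = \<sigma>}"
  have finP: "finite P" by (simp add: P_def)
  have cardP: "card P = 2 ^ k" by (simp add: P_def card_msgs_keys[OF lk])
  have M: "?M = Pi_pmf P [] (\<lambda>_. pmf_of_set (vecs n))" by (simp add: random_code_def P_def)
  have "replicate n True \<in> vecs n" by (simp add: vecs_def)
  then have q0: "0 \<le> q" using q by (meson divide_nonneg_nonneg of_nat_0_le_iff order_trans zero_le_numeral zero_le_power)
  have finF: "finite ?F" by (rule finite_subset[of _ "Pow {..<n}"]) auto
  have "card ?F \<le> card (Pow {..<n})" by (intro card_mono) auto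
  then have cardF: "card ?F \<le> 2 ^ n" by (simp add: card_Pow)
  define X1 where "X1 y = {code. 2 * T \<le> card {p \<in> P. code p \<in> hball n r y}}" for y
  \<comment> \<open>Sparsity is part of the event because the moment bound for confusable codewords
    needs it; outside all \<open>X1 y\<close> it holds for every centre, with
    \<open>d = 2 * T\<close>.\<close>
  define X2 where "X2 = (\<lambda>(S, x0, e). {code. (\<forall>p\<in>P. code p \<in> vecs n) \<and>
      (\<forall>y\<in>vecs n. card {p \<in> P. code p \<in> hball n r y} \<le> 2 * T) \<and>
      u + t * (2 + 2 * (2 * T)) \<le> card {p \<in> confusable n r P code e. code p \<in> agreeing n S x0}})"
  define X3 where "X3 = (\<lambda>(S, m, x0). {code :: nat \<times> nat \<Rightarrow> bool list.
      4 * n < card {j \<in> keys l. code (m, j) \<in> agreeing n S x0}})"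
  have p1: "measure_pmf.prob ?M (\<Union>y\<in>vecs n. X1 y) \<le> ?b1"
  proof (rule prob_UN_le)
    fix y assume "y \<in> vecs n"
    then show "measure_pmf.prob ?M (X1 y) \<le> (2 ^ k * q) ^ T"
      using prob_crowded_ball_le[OF finP T q] by (simp add: X1_def M cardP)
  qed (use q0 in \<open>auto simp: card_vecs\<close>)
  have p2: "measure_pmf.prob ?M (\<Union>i\<in>?F \<times> vecs n \<times> vecs n. X2 i) \<le> ?b2"
  proof (rule prob_UN_le)
    fix i assume "i \<in> ?F \<times> vecs n \<times> vecs n"
    then obtain S x0 e where i: "i = (S, x0, e)" "S \<subseteq> {..<n}" "card S = \<sigma>" "e \<in> vecs n" by auto
    then show "measure_pmf.prob ?M (X2 i) \<le> (2 ^ k / 2 ^ \<sigma> * (2 ^ k * q) / real u) ^ t"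
      using prob_many_confusable_le[OF finP i(2,4) u q, where dflt = "[]" and d = "2 * T" and t = t and ?x0.0 = x0]
      by (simp add: X2_def M cardP)
  next
    have "card (?F \<times> vecs n \<times> vecs n) \<le> 2 ^ n * (2 ^ n * 2 ^ n)"
      using cardF by (simp add: card_cartesian_product card_vecs)
    also have "\<dots> = 2 ^ (3 * n)" by (simp flip: power_add)
    finally have "real (card (?F \<times> vecs n \<times> vecs n)) \<le> real (2 ^ (3 * n))"
      by (simp only: of_nat_le_iff)
    then show "real (card (?F \<times> vecs n \<times> vecs n)) \<le> 2 ^ (3 * n)" by simp
  qed (use q0 finF in auto)
  have p3: "measure_pmf.prob ?M (\<Union>i\<in>?F \<times> msgs k l \<times> vecs n. X3 i) \<le> ?b3"
  proof (rule prob_UN_le)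
    fix i assume "i \<in> ?F \<times> msgs k l \<times> vecs n"
    then obtain S m x0 where i: "i = (S, m, x0)" "S \<subseteq> {..<n}" "card S = \<sigma>" "m \<in> msgs k l" by auto
    then show "measure_pmf.prob ?M (X3 i) \<le> (1 / 2) ^ (4 * n)"
      using prob_many_keys_agree_le[OF i(2) _ i(4), of "4 * n" x0] l by (simp add: X3_def)
  next
    have "(2::nat) ^ (k - l) \<le> 2 ^ n" using kn by (intro power_increasing) auto
    then have "card (?F \<times> msgs k l \<times> vecs n) \<le> 2 ^ n * (2 ^ n * 2 ^ n)"
      using cardF by (auto simp: card_cartesian_product card_vecs intro!: mult_mono)
    also have "\<dots> = 2 ^ (3 * n)" by (simp flip: power_add)
    finally have "real (card (?F \<times> msgs k l \<times> vecs n)) \<le> real (2 ^ (3 * n))"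
      by (simp only: of_nat_le_iff)
    then show "real (card (?F \<times> msgs k l \<times> vecs n)) \<le> 2 ^ (3 * n)" by simp
  qed (use finF in auto)
  let ?bad = "(\<Union>y\<in>vecs n. X1 y) \<union> (\<Union>i\<in>?F \<times> vecs n \<times> vecs n. X2 i) \<union>
      (\<Union>i\<in>?F \<times> msgs k l \<times> vecs n. X3 i)"
  have "1 = measure_pmf.prob ?M (set_pmf ?M)"
    by (simp add: measure_pmf.prob_eq_1 AE_measure_pmf_iff)
  also have "\<dots> \<le> measure_pmf.prob ?M (?G \<union> ?bad)"
  proof (intro measure_pmf.finite_measure_mono subsetI)
    fix code assume "code \<in> set_pmf ?M"
    then have "code \<in> PiE_dflt P [] (set_pmf \<circ> (\<lambda>_. pmf_of_set (vecs n)))"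
      by (simp add: M set_Pi_pmf[OF finP])
    then have code: "\<forall>p\<in>P. code p \<in> vecs n" by (auto simp: PiE_dflt_def)
    show "code \<in> ?G \<union> ?bad"
    proof (rule UnCI)
      assume nb: "code \<notin> ?bad"
      then have "\<forall>y\<in>vecs n. code \<notin> X1 y" by blast
      then have sparse: "\<forall>y\<in>vecs n. card {p \<in> P. code p \<in> hball n r y} \<le> 2 * T"
        by (auto simp: X1_def)
      have conf: "card {p \<in> confusable n r P code e. code p \<in> agreeing n S x0} < u + t * (2 + 4 * T)"
        if "S \<subseteq> {..<n}" "card S = \<sigma>" "x0 \<in> vecs n" "e \<in> vecs n" for S x0 e
      proof -
        have "(S, x0, e) \<in> ?F \<times> vecs n \<times> vecs n" using that by simp
        then have "code \<notin> X2 (S, x0, e)" using nb by blast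
        then show ?thesis using code sparse by (simp add: X2_def)
      qed
      have agr: "card {j \<in> keys l. code (m, j) \<in> agreeing n S x0} \<le> 4 * n"
        if "S \<subseteq> {..<n}" "card S = \<sigma>" "m \<in> msgs k l" "x0 \<in> vecs n" for S m x0
      proof -
        have "(S, m, x0) \<in> ?F \<times> msgs k l \<times> vecs n" using that by simp
        then have "code \<notin> X3 (S, m, x0)" using nb by blast
        then show ?thesis by (simp add: X3_def)
      qed
      show "code \<in> ?G" using code conf agr by simp
    qed
  qed simp
  also have "\<dots> \<le> measure_pmf.prob ?M ?G + measure_pmf.prob ?M ?bad"
    by (rule measure_Un_le) auto
  also have "measure_pmf.prob ?M ?bad \<le> measure_pmf.prob ?M (\<Union>y\<in>vecs n. X1 y) +
      measure_pmf.prob ?M (\<Union>i\<in>?F \<times> vecs n \<times> vecs n. X2 i) +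
      measure_pmf.prob ?M (\<Union>i\<in>?F \<times> msgs k l \<times> vecs n. X3 i)"
    by (intro order_trans[OF measure_Un_le] add_mono order_refl measure_Un_le) auto
  finally show ?thesis using p1 p2 p3 by linarith
qed

section \<open>Asymptotics\<close>

lemma bin_entropy_nonneg:
  assumes "0 < p" "p < 1"
  shows "0 \<le> bin_entropy p"
proof -
  have "p * log 2 p \<le> 0" "(1 - p) * log 2 (1 - p) \<le> 0"
    using assms by (auto intro!: mult_nonneg_nonpos)
  then show ?thesis by (simp add: bin_entropy_def)
qed

text \<open>\<open>Q\<close> is the bound \<open>2 ^ k * q\<close> on the expected number of
  codewords in a ball. The choice of \<open>T\<close> gives
  \<open>Q ^ T \<le> 2 powr (- 2 * n)\<close> against \<open>2 ^ n\<close> centres, and that of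
  \<open>t\<close> gives \<open>Q ^ t \<le> 2 powr (- 4 * n)\<close> against
  \<open>2 ^ (3 * n)\<close> triples. Since \<open>u\<close> is proportional to \<gamma>, the ratio
  \<open>\<gamma> / u\<close> costs only a constant factor.\<close>

lemma good_code_union_bound:
  fixes \<epsilon> \<delta> \<gamma> :: real
  assumes \<epsilon>: "0 < \<epsilon>" and T: "2 \<le> \<epsilon> * real T" and t: "4 \<le> \<epsilon> * real t"
    and \<delta>: "0 < \<delta>" and \<gamma>: "0 < \<gamma>" and u: "\<delta> / 2 * \<gamma> \<le> u"
    and Q: "0 \<le> Q" "Q \<le> 2 powr (- \<epsilon> * real n)"
  shows "2 ^ n * Q ^ T + 2 ^ (3 * n) * (\<gamma> * Q / u) ^ t + 2 ^ (3 * n) * (1 / 2) ^ (4 * n)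
    \<le> (2 + (2 / \<delta>) ^ t) * 2 powr - real n"
proof -
  have pow: "Q ^ m \<le> 2 powr (- (\<epsilon> * real m) * real n)" for m
    using power_mono[OF Q(2,1), of m] by (simp add: powr_power mult_ac)
  have le: "2 powr (- (\<epsilon> * real m) * real n) \<le> 2 powr (- c * real n)" if "c \<le> \<epsilon> * real m" for m c
    using that by (intro powr_mono mult_right_mono) auto
  have 1: "2 ^ n * Q ^ T \<le> 2 powr - real n"
  proof -
    have "2 ^ n * Q ^ T \<le> 2 powr real n * 2 powr (- 2 * real n)"
      using order_trans[OF pow le[OF T]] by (intro mult_mono) (auto simp: powr_realpow Q)
    also have "\<dots> = 2 powr - real n" by (simp flip: powr_add)
    finally show ?thesis .
  qed
  have "0 < u" using u \<delta> \<gamma> by (smt (verit) divide_pos_pos mult_pos_pos)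
  have "\<gamma> * Q / u \<le> \<gamma> * Q / (\<delta> / 2 * \<gamma>)"
    using u \<delta> \<gamma> Q \<open>0 < u\<close> by (intro divide_left_mono) auto
  also have "\<dots> = 2 / \<delta> * Q" using \<gamma> by simp
  finally have "(\<gamma> * Q / u) ^ t \<le> (2 / \<delta> * Q) ^ t"
    using \<gamma> Q \<open>0 < u\<close> by (intro power_mono) auto
  also have "\<dots> = (2 / \<delta>) ^ t * Q ^ t" by (rule power_mult_distrib)
  also have "\<dots> \<le> (2 / \<delta>) ^ t * 2 powr (- 4 * real n)"
    using order_trans[OF pow le[OF t]] \<delta> by (intro mult_left_mono) auto
  finally have "2 ^ (3 * n) * (\<gamma> * Q / u) ^ t \<le> 2 ^ (3 * n) * ((2 / \<delta>) ^ t * 2 powr (- 4 * real n))"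
    by (rule mult_left_mono) simp
  also have "\<dots> = (2 / \<delta>) ^ t * (2 powr real (3 * n) * 2 powr (- 4 * real n))"
    by (subst powr_realpow) auto
  also have "\<dots> = (2 / \<delta>) ^ t * 2 powr - real n" by (simp flip: powr_add)
  finally have 2: "2 ^ (3 * n) * (\<gamma> * Q / u) ^ t \<le> (2 / \<delta>) ^ t * 2 powr - real n" .
  have "2 ^ (3 * n) * (1 / 2 :: real) ^ (4 * n) = 2 powr real (3 * n) * 2 powr - real (4 * n)"
    by (simp only: powr_minus powr_realpow power_one_over inverse_eq_divide)
  also have "\<dots> = 2 powr - real n" by (simp flip: powr_add)
  finally show ?thesis using 1 2 by (simp add: algebra_simps)
qed

theorem theorem4p10:
  fixes \<rho>r \<rho>w \<epsilon> :: real
  assumes "0 < \<rho>r" and "\<rho>r < 1" and "0 < \<rho>w" and "\<rho>w < 1/2" and "0 < \<epsilon>"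
    and "\<rho>r < 1 - bin_entropy \<rho>w - 2 * \<epsilon>"
  shows "\<exists>c::nat. \<forall>\<delta>>0. \<forall>\<^sub>F n in sequentially.
    (let R = 1 - bin_entropy \<rho>w - \<epsilon>;
         k = nat \<lfloor>R * real n\<rfloor>;
         l = nat \<lfloor>\<rho>r * real n\<rfloor> - c;
         rate = real (k - l) / real n
     in rate \<ge> 1 - bin_entropy \<rho>w - \<rho>r - \<epsilon> \<and>
        measure_pmf.prob (random_code n k l)
          {code. (\<forall>S E. adversary_ok n \<rho>r \<rho>w S E \<longrightarrow> err_prob k l code S E \<le> \<delta>) \<and>
                 (\<forall>S. S \<subseteq> {..<n} \<and> card S = nat \<lfloor>\<rho>r * real n\<rfloor> \<longrightarrow>
                    \<bar>cond_entropy_pmf (msg_view k l code S) / real n - rate\<bar> \<le> \<delta>)}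
          \<ge> 1 - \<delta>)"
\<comment> \<open>The constant \<open>1\<close> keeps \<open>l\<close> below the number of read
  positions, so that a message has on average at most half a key per view. It also compensates for
  the rounding of \<open>k\<close> in the rate.\<close>
proof (intro exI[of _ 1] allI impI)
  fix \<delta> :: real assume \<delta>: "0 < \<delta>"
  define h where "h = bin_entropy \<rho>w"
  define R where "R = 1 - h - \<epsilon>"
  \<comment> \<open>\<open>T\<close> and \<open>t\<close> depend only on \<epsilon>, so the part
    \<open>K\<close> of the threshold is constant in \<open>n\<close> and vanishes against the
    growing number of codewords per view.\<close>
  define T where "T = nat \<lceil>2 / \<epsilon>\<rceil>"
  define t where "t = nat \<lceil>4 / \<epsilon>\<rceil>"
  define K where "K = real (t * (2 + 4 * T))"
  have h: "0 \<le> h" unfolding h_def using assms by (intro bin_entropy_nonneg) auto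
  have R: "0 < R" "R < 1" "\<rho>r + \<epsilon> < R"
    using assms h by (auto simp: R_def h_def)
  have ceil: "c \<le> \<epsilon> * real (nat \<lceil>c / \<epsilon>\<rceil>)" for c
    using real_nat_ceiling_ge[of "c / \<epsilon>"] \<open>0 < \<epsilon>\<close> by (simp only: pos_divide_le_eq mult.commute)
  have T: "2 \<le> \<epsilon> * real T" "0 < T"
    using ceil[of 2] \<open>0 < \<epsilon>\<close> by (auto simp: T_def simp del: of_nat_nat)
  have t: "4 \<le> \<epsilon> * real t"
    using ceil[of 4] by (simp only: t_def)
  have ev1: "\<forall>\<^sub>F n in sequentially. 1 \<le> \<rho>r * real n"
    using \<open>0 < \<rho>r\<close> by real_asymp
  have ev2: "\<forall>\<^sub>F n in sequentially. 2 * K / \<delta> \<le> \<epsilon> * real n - 1"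
    using \<open>0 < \<epsilon>\<close> by real_asymp
  have ev3: "\<forall>\<^sub>F n in sequentially. (2 + (2 / \<delta>) ^ t) * 2 powr - real n \<le> \<delta>"
  proof -
    have "(\<lambda>n. (2 + (2 / \<delta>) ^ t) * 2 powr - real n) \<longlonglongrightarrow> 0" by real_asymp
    then show ?thesis using \<delta> by (auto dest!: order_tendstoD(2) elim: eventually_mono)
  qed
  have ev4: "\<forall>\<^sub>F n in sequentially. (1 + log 2 (real (4 * n))) / real n \<le> \<delta>"
  proof -
    have "(\<lambda>n. (1 + log 2 (real (4 * n))) / real n) \<longlonglongrightarrow> 0" by real_asymp
    then show ?thesis using \<delta> by (auto dest!: order_tendstoD(2) elim: eventually_mono)
  qed
  have ev5: "\<forall>\<^sub>F n in sequentially. 1 \<le> n" by (rule eventually_ge_at_top)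
  show "\<forall>\<^sub>F n in sequentially.
    (let R = 1 - bin_entropy \<rho>w - \<epsilon>;
         k = nat \<lfloor>R * real n\<rfloor>;
         l = nat \<lfloor>\<rho>r * real n\<rfloor> - 1;
         rate = real (k - l) / real n
     in rate \<ge> 1 - bin_entropy \<rho>w - \<rho>r - \<epsilon> \<and>
        measure_pmf.prob (random_code n k l)
          {code. (\<forall>S E. adversary_ok n \<rho>r \<rho>w S E \<longrightarrow> err_prob k l code S E \<le> \<delta>) \<and>
                 (\<forall>S. S \<subseteq> {..<n} \<and> card S = nat \<lfloor>\<rho>r * real n\<rfloor> \<longrightarrow>
                    \<bar>cond_entropy_pmf (msg_view k l code S) / real n - rate\<bar> \<le> \<delta>)}
          \<ge> 1 - \<delta>)"
    using ev1 ev2 ev3 ev4 ev5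
  proof eventually_elim
    case (elim n)
    define k where "k = nat \<lfloor>R * real n\<rfloor>"
    define \<sigma> where "\<sigma> = nat \<lfloor>\<rho>r * real n\<rfloor>"
    define l where "l = \<sigma> - 1"
    \<comment> \<open>\<gamma> is the number of codewords divided by the number of possible views.
      Of the \<open>\<delta> * \<gamma>\<close> confusable codewords allowed per view, one half goes
      to \<open>u\<close> and the other to \<open>K\<close>.\<close>
    define \<gamma> :: real where "\<gamma> = 2 ^ k / 2 ^ \<sigma>"
    define u where "u = nat \<lceil>\<delta> / 2 * \<gamma>\<rceil>"
    define q where "q = 2 powr (h * real n) / 2 ^ n"
    let ?P = "msgs k l \<times> keys l"
    let ?G = "{code. (\<forall>p\<in>?P. code p \<in> vecs n) \<and>
      (\<forall>S x0 e. S \<subseteq> {..<n} \<and> card S = \<sigma> \<and> x0 \<in> vecs n \<and> e \<in> vecs n \<longrightarrow>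
        card {p \<in> confusable n (\<rho>w * real n) ?P code e. code p \<in> agreeing n S x0} < u + t * (2 + 4 * T)) \<and>
      (\<forall>S m x0. S \<subseteq> {..<n} \<and> card S = \<sigma> \<and> m \<in> msgs k l \<and> x0 \<in> vecs n \<longrightarrow>
        card {j \<in> keys l. code (m, j) \<in> agreeing n S x0} \<le> 4 * n)}"
    have n: "0 < real n" using elim by simp
    have k: "real k \<le> R * real n" "R * real n < real k + 1"
      using R n by (auto simp: k_def)
    have \<sigma>: "real \<sigma> \<le> \<rho>r * real n" "\<rho>r * real n < real \<sigma> + 1" "1 \<le> \<sigma>"
      using elim by (auto simp: \<sigma>_def le_nat_floor)
    have l: "l < \<sigma>" "real l = real \<sigma> - 1" using \<sigma> by (auto simp: l_def)
    \<comment> \<open>The second \<epsilon> of the hypothesis is spent here: \<open>k\<close>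
      exceeds the number of read positions linearly, so \<gamma> tends to infinity.\<close>
    have mono: "(\<rho>r + \<epsilon>) * real n \<le> R * real n" using R n by (intro mult_right_mono) auto
    have \<sigma>k: "real \<sigma> + \<epsilon> * real n - 1 \<le> real k"
      using k \<sigma> mono by (simp add: algebra_simps)
    have "0 < \<epsilon> * real n" using \<open>0 < \<epsilon>\<close> n by simp
    then have lk: "l \<le> k" using \<sigma>k l by linarith
    have "R * real n \<le> real n" using R n by (simp add: mult_le_cancel_right1)
    then have kn: "k \<le> n" using k by linarith
    have rate: "1 - bin_entropy \<rho>w - \<rho>r - \<epsilon> \<le> real (k - l) / real n"
    proof -
      \<comment> \<open>Rounding loses less than one in \<open>k\<close>, and \<open>l\<close> is at
        most \<open>\<rho>r * n - 1\<close>, so the two units cancel.\<close>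
      have "(R - \<rho>r) * real n \<le> real (k - l)"
        using k \<sigma> l lk by (simp add: algebra_simps of_nat_diff)
      then show ?thesis using n by (simp add: R_def h_def field_simps)
    qed
    have u: "\<delta> / 2 * \<gamma> \<le> real u" "real u < \<delta> / 2 * \<gamma> + 1" "0 < u"
    proof -
      have pos: "0 < \<delta> / 2 * \<gamma>" using \<delta> by (simp add: \<gamma>_def)
      then show "0 < u" by (simp add: u_def)
      show "\<delta> / 2 * \<gamma> \<le> real u" unfolding u_def by (rule real_nat_ceiling_ge)
      show "real u < \<delta> / 2 * \<gamma> + 1" using pos unfolding u_def by linarith
    qed
    have K: "K \<le> \<delta> / 2 * \<gamma>"
    proof -
      have \<sigma>_le_k: "\<sigma> \<le> k" if "0 \<le> \<epsilon> * real n - 1" using \<sigma>k that by linarith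
      have "0 \<le> 2 * K / \<delta>" using \<delta> by (simp add: K_def)
      then have *: "\<sigma> \<le> k" using elim \<sigma>_le_k by linarith
      \<comment> \<open>The crude bound by the exponent suffices, since only a constant has to be
        exceeded.\<close>
      have "real (k - \<sigma>) \<le> real (2 ^ (k - \<sigma>))"
        by (simp only: of_nat_le_iff) (simp add: less_imp_le)
      also have "\<dots> = (2::real) ^ (k - \<sigma>)" by simp
      also have "\<dots> = \<gamma>" using * unfolding \<gamma>_def by (intro power_diff) auto
      finally have "2 * K / \<delta> \<le> \<gamma>"
        using elim \<sigma>k * by (simp add: of_nat_diff)
      then show ?thesis using \<delta> by (simp add: field_simps)
    qed
    have Q: "0 \<le> 2 ^ k * q" "2 ^ k * q \<le> 2 powr (- \<epsilon> * real n)"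
    proof -
      show "0 \<le> 2 ^ k * q" by (simp add: q_def)
      have "2 ^ k * q = 2 powr (real k + h * real n - real n)"
        by (simp add: q_def powr_add powr_diff powr_realpow)
      also have "\<dots> \<le> 2 powr (- \<epsilon> * real n)"
        using k by (intro powr_mono) (auto simp: R_def algebra_simps)
      finally show "2 ^ k * q \<le> 2 powr (- \<epsilon> * real n)" .
    qed
    have "1 - \<delta> \<le> 1 - (2 ^ n * (2 ^ k * q) ^ T + 2 ^ (3 * n) * (2 ^ k / 2 ^ \<sigma> * (2 ^ k * q) / real u) ^ t
      + 2 ^ (3 * n) * (1 / 2) ^ (4 * n))"
      using good_code_union_bound[OF \<open>0 < \<epsilon>\<close> T(1) t \<delta> _ u(1) Q] elim by (simp add: \<gamma>_def)
    also have "\<dots> \<le> measure_pmf.prob (random_code n k l) ?G"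
    proof (rule prob_good_code_ge[OF lk kn l(1) T(2) u(3)])
      fix y assume "y \<in> vecs n"
      then show "real (card (hball n (\<rho>w * real n) y)) / 2 ^ n \<le> q"
        using card_hball[of \<rho>w y n] assms by (simp add: q_def h_def divide_right_mono)
    qed
    also have "\<dots> \<le> measure_pmf.prob (random_code n k l)
          {code. (\<forall>S E. adversary_ok n \<rho>r \<rho>w S E \<longrightarrow> err_prob k l code S E \<le> \<delta>) \<and>
                 (\<forall>S. S \<subseteq> {..<n} \<and> card S = \<sigma> \<longrightarrow>
                    \<bar>cond_entropy_pmf (msg_view k l code S) / real n - real (k - l) / real n\<bar> \<le> \<delta>)}"
    proof (intro measure_pmf.finite_measure_mono subsetI CollectI conjI allI impI)
      fix code S E assume G: "code \<in> ?G" and adv: "adversary_ok n \<rho>r \<rho>w S E"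
      have S: "S \<subseteq> {..<n}" "card S = \<sigma>" using adv by (simp_all add: adversary_ok_def \<sigma>_def)
      have "err_prob k l code S E \<le> 2 ^ card S * (\<delta> * \<gamma>) / 2 ^ k"
      proof (rule err_prob_le[OF lk adv])
        fix x0 e assume "x0 \<in> vecs n" "e \<in> vecs n"
        then have "card {p \<in> confusable n (\<rho>w * real n) ?P code e. code p \<in> agreeing n S x0} < u + t * (2 + 4 * T)"
          using G S by blast
        \<comment> \<open>The strict inequality between integers gains one, which pays for the
          ceiling in \<open>u\<close>.\<close>
        then have "real (card {p \<in> confusable n (\<rho>w * real n) ?P code e. code p \<in> agreeing n S x0}) + 1 \<le> real u + K"
          unfolding K_def by linarith
        then show "real (card {p \<in> confusable n (\<rho>w * real n) ?P code e. code p \<in> agreeing n S x0}) \<le> \<delta> * \<gamma>"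
          using u(2) K by linarith
      qed (use G in blast)
      then show "err_prob k l code S E \<le> \<delta>" by (simp add: S \<gamma>_def)
    next
      fix code S assume G: "code \<in> ?G" and S: "S \<subseteq> {..<n} \<and> card S = \<sigma>"
      let ?H = "cond_entropy_pmf (msg_view k l code S)"
      have bounds: "?H \<le> real (k - l)" "real k - real (card S) - log 2 (real (4 * n)) \<le> ?H"
      proof -
        have S': "S \<subseteq> {..<n}" using S by simp
        have pos: "0 < real (4 * n)" using n by simp
        have code: "\<And>p. p \<in> ?P \<Longrightarrow> code p \<in> vecs n" using G by blast
        have few: "\<And>m x0. m \<in> msgs k l \<Longrightarrow> x0 \<in> vecs n \<Longrightarrow>
            real (card {j \<in> keys l. code (m, j) \<in> agreeing n S x0}) \<le> real (4 * n)"
          unfolding of_nat_le_iff using G S by blast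
        show "?H \<le> real (k - l)" "real k - real (card S) - log 2 (real (4 * n)) \<le> ?H"
          using cond_entropy_msg_view_bounds[OF lk S' pos code few] by simp_all
      qed
      \<comment> \<open>The summand \<open>1\<close> is the gap between \<open>l\<close> and
        \<open>card S\<close>.\<close>
      then have "\<bar>?H - real (k - l)\<bar> \<le> 1 + log 2 (real (4 * n))"
        using l lk S by (simp add: of_nat_diff)
      then have "\<bar>?H - real (k - l)\<bar> / real n \<le> (1 + log 2 (real (4 * n))) / real n"
        using n by (intro divide_right_mono) auto
      also have "\<dots> \<le> \<delta>" by (rule elim)
      finally show "\<bar>?H / real n - real (k - l) / real n\<bar> \<le> \<delta>"
        using n by (simp add: abs_divide flip: diff_divide_distrib)
    qed simp
    finally show ?case
      using rate by (simp add: Let_def k_def l_def \<sigma>_def R_def h_def)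
  qed
qed

end
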